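(* Consider the linear equality constrained problem $\min_xf(x)$ subject to $Ax=b$, where $A\in\mathbb{R}^{m\times n}$ is nonzero and not assumed to have full row rank, $b\in\mathcal R(A)$, $\|A\|\le L_A$, and let $\underline\sigma_{\min}$ be the minimum nonzero singular value of $A$ and $\underline\kappa_A:=L_A/\underline\sigma_{\min}$. Assume $f$ is $L_f$-smooth. Then, using the Inexact PPA algorithm of the context (started from $\lambda_0=0$), the following upper bounds on the number of gradient evaluations hold. (i) If $f$ is $\mu_f$-strongly convex and $\kappa_f=L_f/\mu_f$, an approximate solution $x$ with $\|x-x^\star\|^2\le\epsilon$ is found by the Inexact PPA algorithm within $\tilde O\left(\underline\kappa_A\sqrt{\kappa_f}\log(1/\epsilon)\right)$ gradient evaluations. (ii) If $f$ is convex and $\|x_0-x^\star\|\le D$, then for any $0<\rho<+\infty$, a point $x$ with $f(x)+\rho\|Ax-b\|-\min_{Ax'=b}f(x')\le\epsilon$ is found, by applying the Inexact PPA algorithm to $\min_{Ax=b}f(x)+\frac{\epsilon}{2D^2}\|x-x_0\|^2$, within $\tilde O\left(\frac{\underline\kappa_A\sqrt{L_f}D}{\sqrt\epsilon}\right)$ gradient evaluations. (iii) If $f$ is possibly non-convex, $Ax_0=b$ and $f(x_0)-\inf_{Ax=b}f(x)\le\Delta$, then a point $x$ with $L_f\left\|x-\mathcal P_{\{Ax=b\}}\left(x-\frac1{2L_f}\nabla f(x)\right)\right\|\le\epsilon$ is found, by the proximal point method that successively solves the subproblems $\min_{Ax=b}f(x)+L_f\|x-x_{k-1}\|^2$ by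 the Inexact PPA algorithm up to error $\|x_k-x_k^\star\|\le\delta_k=\frac{\sqrt{\Delta/L_f}}{2k}$ ($x_k^\star$ the exact subproblem solution), within $\tilde O\left(\frac{\underline\kappa_AL_f\Delta}{\epsilon^2}\right)$ gradient evaluations.
   Context: $x^\star$ denotes an optimal solution (the unique one in (i)), $\mathcal R(A)$ the range of $A$, $\mathcal P_{\mathcal M}$ the Euclidean projection onto a closed convex set $\mathcal M$. Inexact PPA algorithm for $\min_{Ax=b}\phi(x)$ with $\phi$ $L$-smooth and $\mu$-strongly convex: input $x_0$, $\lambda_0=0$, $\ell\ge\mu_\Phi:=\underline\sigma_{\min}^2/L$ (suitably chosen), radius $R>0$; let $r=\frac{\mu_\Phi}{12\ell}$, $\delta_k=(1-r)^{k/2}R$. For $k=1,\dots,T$: with $\Psi_k(x)=\phi(x)+\max_\lambda\{\lambda^{\mathrm T}(Ax-b)-\frac\ell2\|\lambda-\lambda_{k-1}\|^2\}$, which is $(L+L_A^2/\ell)$-smooth and $\mu$-strongly convex, let $x_k=\mathrm{AGD}(\Psi_k,x_{k-1},\delta_k)$ and $\lambda_k=\lambda_{k-1}+\frac{Ax_k-b}\ell$. Output $x_T$. $\mathrm{AGD}(\Psi,y_0,\delta)$ for $L$-smooth $\mu$-strongly convex $\Psi$: $\theta=\frac{\sqrt{L/\mu}-1}{\sqrt{L/\mu}+1}$, $y_{-1}=y_0$; iterate $\tilde y_{k+1}=y_k+\theta(y_k-y_{k-1})$, $y_{k+1}=\tilde y_{k+1}-\frac1L\nabla\Psi(\tilde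 y_{k+1})$ until $\|\nabla\Psi(y_T)\|\le\mu\delta$; output $y_T$. $\tilde O$ hides universal constants and logarithmic factors in the problem parameters, initial distances to primal and dual solutions, $\rho$, and (in (ii), (iii)) $1/\epsilon$. Gradient evaluations are evaluations of $\nabla f$. *)

theory Defs
  imports "HOL-Analysis.Analysis"
begin

section \<open>Smoothness, strong convexity, singular values\<close>

definition grad :: "('a::real_inner \<Rightarrow> real) \<Rightarrow> 'a \<Rightarrow> 'a" where
  "grad f x = (THE D. GDERIV f x :> D)"

definition smooth_fun :: "real \<Rightarrow> ('a::real_inner \<Rightarrow> real) \<Rightarrow> bool" where
  "smooth_fun L f \<longleftrightarrow> (\<forall>x. GDERIV f x :> grad f x) \<and> L-lipschitz_on UNIV (grad f)"

definition strongly_convex :: "real \<Rightarrow> ('a::real_inner \<Rightarrow> real) \<Rightarrow> bool" where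
  "strongly_convex \<mu> f \<longleftrightarrow> convex_on UNIV (\<lambda>x. f x - \<mu> / 2 * (norm x)\<^sup>2)"

definition singular_value :: "real^'n^'m \<Rightarrow> real \<Rightarrow> bool" where
  "singular_value A s \<longleftrightarrow>
     s \<ge> 0 \<and> (\<exists>v. v \<noteq> 0 \<and> (transpose A ** A) *v v = s\<^sup>2 *\<^sub>R v)"

text \<open>For \<open>A \<noteq> 0\<close> the set below is finite and nonempty, so the infimum is a minimum.\<close>

definition sigma_min :: "real^'n^'m \<Rightarrow> real" where
  "sigma_min A = Inf {s. singular_value A s \<and> s \<noteq> 0}"


section \<open>Linearly constrained problems\<close>

abbreviation optimal_solution ::
  "('a::euclidean_space \<Rightarrow> real) \<Rightarrow> 'a set \<Rightarrow> 'a \<Rightarrow> bool" where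
  "optimal_solution f S x \<equiv> is_arg_min f (\<lambda>y. y \<in> S) x"

definition feasible :: "real^'n^'m \<Rightarrow> real^'m \<Rightarrow> (real^'n) set" where
  "feasible A b = {x. A *v x = b}"

text \<open>The dual function may take the value \<open>-\<infinity>\<close>, hence the extended reals.\<close>

definition dual_fun ::
  "real^'n^'m \<Rightarrow> real^'m \<Rightarrow> (real^'n \<Rightarrow> real) \<Rightarrow> real^'m \<Rightarrow> ereal" where
  "dual_fun A b f l = (INF x. ereal (f x + l \<bullet> (A *v x - b)))"

definition dual_solutions ::
  "real^'n^'m \<Rightarrow> real^'m \<Rightarrow> (real^'n \<Rightarrow> real) \<Rightarrow> (real^'m) set" where
  "dual_solutions A b f = {l. is_arg_max (dual_fun A b f) (\<lambda>_. True) l}"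


section \<open>Accelerated gradient descent\<close>

text \<open>The state after \<open>k\<close> iterations is the pair of \<open>y\<^sub>k\<close> and its predecessor.\<close>

fun agd_state ::
  "('a::real_inner \<Rightarrow> real) \<Rightarrow> real \<Rightarrow> real \<Rightarrow> 'a \<Rightarrow> nat \<Rightarrow> 'a \<times> 'a" where
  "agd_state \<Psi> L \<mu> y0 0 = (y0, y0)"
| "agd_state \<Psi> L \<mu> y0 (Suc k) =
     (let (y, y') = agd_state \<Psi> L \<mu> y0 k;
          \<theta> = (sqrt (L / \<mu>) - 1) / (sqrt (L / \<mu>) + 1);
          z = y + \<theta> *\<^sub>R (y - y')
      in (z - (1 / L) *\<^sub>R grad \<Psi> z, y))"

definition agd_iterate ::
  "('a::real_inner \<Rightarrow> real) \<Rightarrow> real \<Rightarrow> real \<Rightarrow> 'a \<Rightarrow> nat \<Rightarrow> 'a" where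
  "agd_iterate \<Psi> L \<mu> y0 k = fst (agd_state \<Psi> L \<mu> y0 k)"

text \<open>
  \<open>agd \<Psi> L \<mu> y0 \<delta> y N\<close>: the method stops, after exactly \<open>N\<close> iterations, with output \<open>y\<close>.
  The stopping test is made at the end of each iteration, so \<open>N \<ge> 1\<close>.
\<close>

definition agd ::
  "('a::real_inner \<Rightarrow> real) \<Rightarrow> real \<Rightarrow> real \<Rightarrow> 'a \<Rightarrow> real \<Rightarrow> 'a \<Rightarrow> nat \<Rightarrow> bool" where
  "agd \<Psi> L \<mu> y0 \<delta> y N \<longleftrightarrow>
     (let stop = (\<lambda>k. k \<ge> 1 \<and> norm (grad \<Psi> (agd_iterate \<Psi> L \<mu> y0 k)) \<le> \<mu> * \<delta>)
      in stop N \<and> (\<forall>k<N. \<not> stop k) \<and> y = agd_iterate \<Psi> L \<mu> y0 N)"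


section \<open>Inexact proximal point algorithm\<close>

definition ippa_objective ::
  "real^'n^'m \<Rightarrow> real^'m \<Rightarrow> (real^'n \<Rightarrow> real) \<Rightarrow> real \<Rightarrow> real^'m \<Rightarrow> real^'n \<Rightarrow> real" where
  "ippa_objective A b \<phi> ell l0 x =
     \<phi> x + (SUP l. l \<bullet> (A *v x - b) - ell / 2 * (norm (l - l0))\<^sup>2)"

definition mu_Phi :: "real^'n^'m \<Rightarrow> real \<Rightarrow> real" where
  "mu_Phi A L = (sigma_min A)\<^sup>2 / L"

definition ippa_radius :: "real^'n^'m \<Rightarrow> real \<Rightarrow> real \<Rightarrow> real \<Rightarrow> nat \<Rightarrow> real" where
  "ippa_radius A L ell R k =
     (let r = mu_Phi A L / (12 * ell) in (1 - r) powr (real k / 2) * R)"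

text \<open>
  \<open>ippa A b L_A \<phi> L \<mu> ell R x0 k x l c\<close>: after \<open>k\<close> rounds (in each of which the inner solver
  stops) the primal and dual iterates are \<open>x\<close> and \<open>l\<close>, and \<open>c\<close> gradients have been evaluated.
  An iteration of the inner solver costs two evaluations, one at the extrapolated point and
  one for the stopping test.  A gradient of the objective of the inner solver
  takes one gradient of \<open>\<phi>\<close>, and the latter one gradient of \<open>f\<close> whenever \<open>\<phi>\<close> is \<open>f\<close> plus an
  explicit quadratic.
\<close>

inductive ippa ::
  "real^'n^'m \<Rightarrow> real^'m \<Rightarrow> real \<Rightarrow> (real^'n \<Rightarrow> real) \<Rightarrow> real \<Rightarrow> real \<Rightarrow> real \<Rightarrow> real \<Rightarrow> real^'n
    \<Rightarrow> nat \<Rightarrow> real^'n \<Rightarrow> real^'m \<Rightarrow> nat \<Rightarrow> bool"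
  for A b L_A \<phi> L \<mu> ell R x0 where
  init: "ippa A b L_A \<phi> L \<mu> ell R x0 0 x0 0 0"
| step: "ippa A b L_A \<phi> L \<mu> ell R x0 k x l c \<Longrightarrow>
     agd (ippa_objective A b \<phi> ell l) (L + L_A\<^sup>2 / ell) \<mu> x (ippa_radius A L ell R (Suc k)) x' N \<Longrightarrow>
     ippa A b L_A \<phi> L \<mu> ell R x0 (Suc k) x' (l + (1 / ell) *\<^sub>R (A *v x' - b)) (c + 2 * N)"


section \<open>Proximal point method for nonconvex objectives\<close>

definition prox_objective :: "('a::real_inner \<Rightarrow> real) \<Rightarrow> real \<Rightarrow> 'a \<Rightarrow> 'a \<Rightarrow> real" where
  "prox_objective f L_f x' x = f x + L_f * (norm (x - x'))\<^sup>2"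

text \<open>
  If \<open>f\<close> is \<open>L_f\<close>-smooth, then \<open>prox_objective f L_f x'\<close> is \<open>3 L_f\<close>-smooth and
  \<open>L_f\<close>-strongly convex; these constants are passed to the inner algorithm.
\<close>

inductive prox_method ::
  "real^'n^'m \<Rightarrow> real^'m \<Rightarrow> real \<Rightarrow> (real^'n \<Rightarrow> real) \<Rightarrow> real \<Rightarrow> real \<Rightarrow> real \<Rightarrow> real \<Rightarrow> real^'n
    \<Rightarrow> nat \<Rightarrow> real^'n \<Rightarrow> nat \<Rightarrow> bool"
  for A b L_A f L_f \<Delta> ell R x0 where
  init: "prox_method A b L_A f L_f \<Delta> ell R x0 0 x0 0"
| step: "prox_method A b L_A f L_f \<Delta> ell R x0 k x c \<Longrightarrow>
     ippa A b L_A (prox_objective f L_f x) (3 * L_f) L_f ell R x T x' l c' \<Longrightarrow>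
     optimal_solution (prox_objective f L_f x) (feasible A b) xs \<Longrightarrow>
     norm (x' - xs) \<le> sqrt (\<Delta> / L_f) / (2 * real (Suc k)) \<Longrightarrow>
     prox_method A b L_A f L_f \<Delta> ell R x0 (Suc k) x' (c + c')"


section \<open>Complexity bounds up to logarithmic factors\<close>

text \<open>
  \<open>soft_O N M ps\<close>: the count \<open>N\<close> is at most \<open>M\<close> up to a universal constant and a power of the
  logarithms of the positive quantities \<open>ps\<close>.  The constant and the power are numerals because
  an existentially quantified constant could depend on the dimensions, which are types here.
  A nonnegative quantity of which only large values matter enters \<open>ps\<close> increased by \<open>1\<close>.
  A factor \<open>max 1 _\<close> in \<open>M\<close> only serves large tolerances, for which the usual expression would
  drop below the cost of a single step.
\<close>

definition log_factor :: "real list \<Rightarrow> real" where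
  "log_factor ps = 1 + (\<Sum>p\<leftarrow>ps. \<bar>ln p\<bar>)"

definition soft_O :: "nat \<Rightarrow> real \<Rightarrow> real list \<Rightarrow> bool" where
  "soft_O N M ps \<longleftrightarrow> real N \<le> 10 ^ 10 * M * log_factor ps ^ 3"

end

theory Submission
  imports Defs
begin

text \<open>
  Take \<open>ell = mu_Phi A L\<close>, the smallest admissible value.  By cocoercivity of the gradient and
  the lower bound \<open>sigma_min A\<close> of \<open>transpose A\<close> on the range of \<open>A\<close>, an exact proximal step then
  halves the distance of the multiplier to the optimal multiplier in the range of \<open>A\<close>, so that
  logarithmically many outer rounds suffice.  The condition number of the inner problem is
  \<open>L / \<mu> * (1 + (L_A / sigma_min A)\<^sup>2)\<close>, and because the tolerance decays at the same rate as the
  primal and dual errors, every warm-started inner run takes about the square root of this number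
  of iterations times a logarithm that does not grow with the round.

  The convex case follows by regularisation.  In the nonconvex case \<open>3 / 2\<close> times the length of
  an exact proximal step bounds the stationarity measure at the point where the step starts; the
  squared lengths sum to at most \<open>3 / 2 * \<Delta> / L_f\<close>, since the inner errors are square summable.
\<close>

section \<open>Smooth and strongly convex functions\<close>

text \<open>Without full row rank, strong concavity of the dual is available only along the range of
  \<open>A\<close>. The multiplier starts at \<open>0\<close> and moves by multiples of
  \<open>A *v x - b\<close>, so it never leaves that range, and there it has a single target, the
  multiplier of least norm. Bounds with fixed numerals force explicit bookkeeping: every quantity
  that ends up under a logarithm is bounded by a power of \<open>exp (log_factor ps)\<close>, and
  the exponents become constant factors. The logarithms may refer only to the dual solutions of the
  original problem in (ii) and of the first subproblem in (iii). The multipliers of the regularised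
  problem and of the later subproblems are therefore compared with these; the differences are
  controlled by gradients at points whose distances are polynomial in the data. In (iii) the
  iterates may be infeasible, so the values of \<open>f\<close> along them cannot be compared with
  the infimum; a feasible companion point is carried along instead.\<close>

lemma grad_eqI:
  assumes "GDERIV f x :> D"
  shows "grad f x = D"
proof -
  have "D' = D" if "GDERIV f x :> D'" for D'
  proof -
    have "(\<lambda>h. h \<bullet> D') = (\<lambda>h. h \<bullet> D)"
      using that assms unfolding gderiv_def by (rule has_derivative_unique)
    then show ?thesis
      by (metis vector_eq_ldot)
  qed
  with assms show ?thesis
    unfolding grad_def by (intro the_equality)
qed

lemma GDERIV_line:
  assumes "GDERIV f (x + t *\<^sub>R d) :> D"
  shows "((\<lambda>t. f (x + t *\<^sub>R d)) has_real_derivative D \<bullet> d) (at t)"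
proof -
  have 1: "((\<lambda>t. x + t *\<^sub>R d) has_derivative (\<lambda>h. h *\<^sub>R d)) (at t)"
    by (auto intro!: derivative_eq_intros)
  have "((\<lambda>t. f (x + t *\<^sub>R d)) has_derivative (\<lambda>h. (h *\<^sub>R d) \<bullet> D)) (at t)"
    using has_derivative_compose[OF 1] assms unfolding gderiv_def by blast
  then show ?thesis
    by (simp add: has_field_derivative_def inner_commute mult_commute_abs)
qed

lemma descent_upper:
  assumes der: "\<And>x. GDERIV f x :> g x"
    and lip: "\<And>x y. norm (g x - g y) \<le> L * norm (x - y)"
  shows "f y \<le> f x + g x \<bullet> (y - x) + L / 2 * (norm (y - x))\<^sup>2"
proof -
  define d where "d = y - x"
  \<comment> \<open>The gap to the claimed bound along the segment: a nonpositive derivative of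
    \<open>h\<close> replaces integrating the gradient.\<close>
  define h where "h t = f (x + t *\<^sub>R d) - t * (g x \<bullet> d) - L / 2 * t\<^sup>2 * (norm d)\<^sup>2" for t
  have dh: "(h has_real_derivative
      g (x + t *\<^sub>R d) \<bullet> d - g x \<bullet> d - L * t * (norm d)\<^sup>2) (at t)" for t
    unfolding h_def
    by (rule derivative_eq_intros GDERIV_line der refl | simp)+
  have "h 1 \<le> h 0"
  proof (rule DERIV_nonpos_imp_nonincreasing[of 0 1 h])
    fix t :: real assume t: "0 \<le> t" "t \<le> 1"
    have "(g (x + t *\<^sub>R d) - g x) \<bullet> d \<le> norm (g (x + t *\<^sub>R d) - g x) * norm d"
      by (rule norm_cauchy_schwarz)
    also have "\<dots> \<le> (L * norm (t *\<^sub>R d)) * norm d"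
      using lip[of "x + t *\<^sub>R d" x] by (intro mult_right_mono) auto
    also have "\<dots> = L * t * (norm d)\<^sup>2"
      using t by (simp add: power2_eq_square)
    finally have "g (x + t *\<^sub>R d) \<bullet> d - g x \<bullet> d - L * t * (norm d)\<^sup>2 \<le> 0"
      by (simp add: inner_diff_left)
    then show "\<exists>D. (h has_real_derivative D) (at t) \<and> D \<le> 0"
      using dh by blast
  qed simp
  then show ?thesis
    by (simp add: h_def d_def)
qed

lemma descent_lower:
  assumes der: "\<And>x. GDERIV f x :> g x"
    and lip: "\<And>x y. norm (g x - g y) \<le> L * norm (x - y)"
  shows "f y \<ge> f x + g x \<bullet> (y - x) - L / 2 * (norm (y - x))\<^sup>2"
  using descent_upper[of "\<lambda>x. - f x" "\<lambda>x. - g x" L y x] assms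
  by (simp add: GDERIV_minus norm_minus_commute inner_minus_left)

text \<open>The gradient \<open>g\<close> is carried as an explicit map, so that composite
  objectives can be handled by formula. The modulus \<open>\<mu>\<close> may be zero or negative, so
  that convex and nonconvex functions fall under the same predicate.\<close>

definition sc_smooth ::
  "real \<Rightarrow> real \<Rightarrow> ('a::real_inner \<Rightarrow> real) \<Rightarrow> ('a \<Rightarrow> 'a) \<Rightarrow> bool" where
  "sc_smooth \<mu> L f g \<longleftrightarrow> (\<forall>x. GDERIV f x :> g x) \<and>
     (\<forall>x y. norm (g x - g y) \<le> L * norm (x - y)) \<and>
     (\<forall>x y. f x + g x \<bullet> (y - x) + \<mu> / 2 * (norm (y - x))\<^sup>2 \<le> f y)"

lemma sc_smoothD:
  assumes "sc_smooth \<mu> L f g"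
  shows "GDERIV f x :> g x" "grad f x = g x"
    "norm (g x - g y) \<le> L * norm (x - y)"
    "f x + g x \<bullet> (y - x) + \<mu> / 2 * (norm (y - x))\<^sup>2 \<le> f y"
    "f y \<le> f x + g x \<bullet> (y - x) + L / 2 * (norm (y - x))\<^sup>2"
proof -
  show "f y \<le> f x + g x \<bullet> (y - x) + L / 2 * (norm (y - x))\<^sup>2"
    using assms by (intro descent_upper) (auto simp: sc_smooth_def)
qed (use assms in \<open>auto simp: sc_smooth_def intro!: grad_eqI\<close>)

lemma smooth_funD:
  assumes "smooth_fun L f"
  shows "GDERIV f x :> grad f x" "norm (grad f x - grad f y) \<le> L * norm (x - y)"
  using assms by (auto simp: smooth_fun_def lipschitz_on_def dist_norm)

lemma GDERIV_norm_square: "GDERIV (\<lambda>x. c * (norm (x - a))\<^sup>2) x :> (2 * c) *\<^sub>R (x - a)"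
  unfolding gderiv_def power2_norm_eq_inner
  by (auto intro!: derivative_eq_intros simp: inner_commute algebra_simps)

text \<open>Restriction to the line through \<open>x\<close> and \<open>y\<close> reduces this to
  the tangent inequality for functions of one real variable.\<close>

lemma convex_on_tangent:
  assumes "convex_on UNIV f" and der: "GDERIV f x :> D"
  shows "f x + D \<bullet> (y - x) \<le> f y"
proof -
  have "convex_on UNIV (\<lambda>t. f (x + t *\<^sub>R (y - x)))"
  proof (rule convex_onI)
    fix t u v :: real assume t: "0 < t" "t < 1"
    have "x + ((1 - t) *\<^sub>R u + t *\<^sub>R v) *\<^sub>R (y - x) =
        (1 - t) *\<^sub>R (x + u *\<^sub>R (y - x)) + t *\<^sub>R (x + v *\<^sub>R (y - x))"
      by (simp add: algebra_simps)
    then show "f (x + ((1 - t) *\<^sub>R u + t *\<^sub>R v) *\<^sub>R (y - x))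
        \<le> (1 - t) * f (x + u *\<^sub>R (y - x)) + t * f (x + v *\<^sub>R (y - x))"
      using convex_onD[OF assms(1), of t] t by simp
  qed simp
  moreover have "((\<lambda>t. f (x + t *\<^sub>R (y - x))) has_real_derivative D \<bullet> (y - x)) (at 0)"
    by (rule GDERIV_line) (use der in simp)
  ultimately have "D \<bullet> (y - x) * (1 - 0) \<le> f (x + 1 *\<^sub>R (y - x)) - f (x + 0 *\<^sub>R (y - x))"
    by (intro convex_on_imp_above_tangent[where A = UNIV]) auto
  then show ?thesis
    by simp
qed

lemma sc_smoothI_strongly_convex:
  assumes "smooth_fun L f" "strongly_convex \<mu> f"
  shows "sc_smooth \<mu> L f (grad f)"
  unfolding sc_smooth_def
proof (intro conjI allI)
  fix x y :: 'a
  show "f x + grad f x \<bullet> (y - x) + \<mu> / 2 * (norm (y - x))\<^sup>2 \<le> f y"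
  proof -
    have "GDERIV (\<lambda>x. f x - \<mu> / 2 * (norm x)\<^sup>2) x :> grad f x - \<mu> *\<^sub>R x"
      using GDERIV_diff[OF smooth_funD(1)[OF assms(1)] GDERIV_norm_square[of "\<mu> / 2" 0]]
      by simp
    from convex_on_tangent[OF assms(2)[unfolded strongly_convex_def] this, of y]
    show ?thesis
      unfolding power2_norm_eq_inner
      by (simp add: algebra_simps inner_commute)
  qed
qed (use smooth_funD[OF assms(1)] in auto)

lemma sc_smoothI_convex:
  assumes "smooth_fun L f" "convex_on UNIV f"
  shows "sc_smooth 0 L f (grad f)"
  using assms by (intro sc_smoothI_strongly_convex) (auto simp: strongly_convex_def)

lemma sc_smooth_add_square:
  assumes "sc_smooth \<mu> L f g" "0 \<le> c"
  shows "sc_smooth (\<mu> + 2 * c) (L + 2 * c)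
    (\<lambda>x. f x + c * (norm (x - a))\<^sup>2) (\<lambda>x. g x + (2 * c) *\<^sub>R (x - a))"
  unfolding sc_smooth_def
proof (intro conjI allI)
  fix x y
  show "GDERIV (\<lambda>x. f x + c * (norm (x - a))\<^sup>2) x :> g x + (2 * c) *\<^sub>R (x - a)"
    by (intro GDERIV_add GDERIV_norm_square sc_smoothD(1)[OF assms(1)])
  have "g x + (2 * c) *\<^sub>R (x - a) - (g y + (2 * c) *\<^sub>R (y - a)) =
      (g x - g y) + (2 * c) *\<^sub>R (x - y)"
    by (simp add: algebra_simps)
  moreover have "norm ((g x - g y) + (2 * c) *\<^sub>R (x - y)) \<le>
      L * norm (x - y) + 2 * c * norm (x - y)"
    using norm_triangle_mono[OF sc_smoothD(3)[OF assms(1), of x y],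
        of "(2 * c) *\<^sub>R (x - y)" "2 * c * norm (x - y)"] assms(2)
    by simp
  ultimately show "norm (g x + (2 * c) *\<^sub>R (x - a) - (g y + (2 * c) *\<^sub>R (y - a))) \<le>
      (L + 2 * c) * norm (x - y)"
    by (simp add: algebra_simps)
  have "c * (norm (y - a))\<^sup>2 =
      c * (norm (x - a))\<^sup>2 + (2 * c) *\<^sub>R (x - a) \<bullet> (y - x) + c * (norm (y - x))\<^sup>2"
    unfolding power2_norm_eq_inner by (simp add: algebra_simps inner_commute)
  moreover have "(\<mu> + 2 * c) / 2 * (norm (y - x))\<^sup>2 =
      \<mu> / 2 * (norm (y - x))\<^sup>2 + c * (norm (y - x))\<^sup>2"
    by (simp add: field_simps)
  ultimately show "f x + c * (norm (x - a))\<^sup>2 + (g x + (2 * c) *\<^sub>R (x - a)) \<bullet> (y - x)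
      + (\<mu> + 2 * c) / 2 * (norm (y - x))\<^sup>2 \<le> f y + c * (norm (y - a))\<^sup>2"
    using sc_smoothD(4)[OF assms(1), of x y] unfolding inner_add_left by linarith
qed

text \<open>The negative modulus is what \<open>sc_smooth_add_square\<close> repairs: adding
  \<open>L * (norm (x - a))\<^sup>2\<close> raises \<open>- L\<close> to \<open>L\<close> and the
  smoothness constant to \<open>3 * L\<close>.\<close>

lemma sc_smooth_nonconvex:
  assumes "smooth_fun L f"
  shows "sc_smooth (- L) L f (grad f)"
  using smooth_funD[OF assms] descent_lower[of f "grad f" L]
  unfolding sc_smooth_def by auto

lemma sc_smooth_strong_monotone:
  assumes "sc_smooth \<mu> L f g"
  shows "\<mu> * (norm (x - y))\<^sup>2 \<le> (g x - g y) \<bullet> (x - y)"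
  using sc_smoothD(4)[OF assms, of x y] sc_smoothD(4)[OF assms, of y x]
  by (simp add: inner_diff_left inner_diff_right norm_minus_commute field_simps)

lemma sc_smooth_norm_le_grad:
  assumes "sc_smooth \<mu> L f g"
  shows "\<mu> * norm (x - y) \<le> norm (g x - g y)"
proof (cases "x = y")
  case False
  have "\<mu> * norm (x - y) * norm (x - y) \<le> norm (g x - g y) * norm (x - y)"
    using sc_smooth_strong_monotone[OF assms, of x y] norm_cauchy_schwarz[of "g x - g y" "x - y"]
    by (simp add: power2_eq_square)
  then show ?thesis
    using False by simp
qed simp

text \<open>A unit vector, which every Euclidean space has, lets the lower and the upper bound on a
  gradient difference be compared.\<close>

lemma sc_smooth_le:
  fixes g :: "'a::euclidean_space \<Rightarrow> 'a"
  assumes "sc_smooth \<mu> L f g"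
  shows "\<mu> \<le> L"
proof -
  obtain d :: 'a where "norm d = 1"
    using vector_choose_size[of 1] by auto
  then show ?thesis
    using sc_smooth_norm_le_grad[OF assms, of d 0] sc_smoothD(3)[OF assms, of d 0] by simp
qed

text \<open>One gradient step of length \<open>1 / L\<close> lowers the value by at least
  \<open>(norm (g x))\<^sup>2 / (2 * L)\<close>, and it cannot go below \<open>m\<close>.\<close>

lemma grad_norm_sq_le:
  assumes "sc_smooth \<mu> L f g" "0 < L" "\<And>y. m \<le> f y"
  shows "(norm (g x))\<^sup>2 \<le> 2 * L * (f x - m)"
proof -
  have "m \<le> f (x - (1 / L) *\<^sub>R g x)"
    by (rule assms(3))
  also have "\<dots> \<le> f x + g x \<bullet> (- (1 / L) *\<^sub>R g x) + L / 2 * (norm ((1 / L) *\<^sub>R g x))\<^sup>2"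
    using sc_smoothD(5)[OF assms(1), of "x - (1 / L) *\<^sub>R g x" x] by simp
  also have "\<dots> = f x - (norm (g x))\<^sup>2 / (2 * L)"
    using assms(2) by (simp add: power_divide power2_norm_eq_inner[symmetric]) (simp add: field_simps power2_eq_square)
  finally show ?thesis
    using assms(2) by (simp add: field_simps)
qed

text \<open>Tilting \<open>f\<close> by the linear functional of \<open>g x\<close> makes
  \<open>x\<close> a minimiser, so \<open>grad_norm_sq_le\<close> at \<open>y\<close> sharpens the
  tangent inequality by a squared gradient difference. Adding the two versions with \<open>x\<close>
  and \<open>y\<close> exchanged gives the claim.\<close>

lemma sc_smooth_cocoercive:
  assumes "sc_smooth \<mu> L f g" "0 \<le> \<mu>" "0 < L"
  shows "(norm (g x - g y))\<^sup>2 \<le> L * ((g x - g y) \<bullet> (x - y))"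
proof -
  have half: "f x + g x \<bullet> (y - x) + (norm (g x - g y))\<^sup>2 / (2 * L) \<le> f y" for x y
  proof -
    define h where "h z = f z - g x \<bullet> z" for z
    have "GDERIV (\<lambda>z. g x \<bullet> z) z :> g x" for z
      unfolding gderiv_def by (auto intro!: derivative_eq_intros simp: inner_commute)
    then have "sc_smooth \<mu> L h (\<lambda>z. g z - g x)"
      using assms(1) unfolding sc_smooth_def h_def
      by (auto intro!: GDERIV_diff simp: algebra_simps)
    moreover have "h x \<le> h z" for z
    proof -
      have "0 \<le> \<mu> / 2 * (norm (z - x))\<^sup>2"
        using assms(2) by simp
      then show ?thesis
        using sc_smoothD(4)[OF assms(1), of x z] unfolding h_def inner_diff_right by linarith
    qed
    ultimately have "(norm (g y - g x))\<^sup>2 \<le> 2 * L * (h y - h x)"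
      using assms(3) by (intro grad_norm_sq_le)
    then show ?thesis
      using assms(3) by (simp add: h_def field_simps norm_minus_commute inner_diff_right)
  qed
  show ?thesis
    using half[of x y] half[of y x] assms(3)
    by (simp add: norm_minus_commute field_simps inner_diff_left inner_diff_right)
qed

lemma sc_smooth_continuous:
  assumes "sc_smooth \<mu> L f g"
  shows "continuous_on S f"
  using sc_smoothD(1)[OF assms] unfolding gderiv_def
  by (meson continuous_at_imp_continuous_on has_derivative_continuous)

lemma sc_smooth_attains_min:
  fixes g :: "'a::euclidean_space \<Rightarrow> 'a"
  assumes sc: "sc_smooth \<mu> L f g" and "0 < \<mu>" and S: "closed S" "a \<in> S"
  shows "\<exists>x. optimal_solution f S x"
proof -
  \<comment> \<open>Beyond this radius the quadratic term of the lower bound at \<open>a\<close>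
    outweighs its linear term.\<close>
  define r where "r = 2 * norm (g a) / \<mu>"
  have out: "f a < f y" if "r < norm (y - a)" for y
  proof -
    have pos: "0 < norm (y - a)"
      using that \<open>0 < \<mu>\<close> unfolding r_def
      by (metis divide_nonneg_pos mult_nonneg_nonneg norm_ge_zero order_le_less_trans zero_le_numeral)
    have "norm (g a) < \<mu> / 2 * norm (y - a)"
      using that \<open>0 < \<mu>\<close> by (simp add: r_def field_simps)
    then have "norm (g a) * norm (y - a) < \<mu> / 2 * (norm (y - a))\<^sup>2"
      using pos by (simp add: power2_eq_square)
    moreover have "- (norm (g a) * norm (y - a)) \<le> g a \<bullet> (y - a)"
      using Cauchy_Schwarz_ineq2[of "g a" "y - a"] by linarith
    ultimately show ?thesis
      using sc_smoothD(4)[OF sc, of a y] by linarith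
  qed
  have "0 \<le> r"
    using \<open>0 < \<mu>\<close> by (simp add: r_def)
  then have "a \<in> S \<inter> cball a r"
    using S by simp
  then obtain x where x: "x \<in> S \<inter> cball a r" "\<forall>y \<in> S \<inter> cball a r. f x \<le> f y"
    using continuous_attains_inf[of "S \<inter> cball a r" f] S sc_smooth_continuous[OF sc]
    by (metis closed_Int_compact compact_cball empty_iff)
  have "f x \<le> f y" if "y \<in> S" for y
  proof (cases "r < norm (y - a)")
    case True
    then show ?thesis
      using out[OF True] x(2) \<open>a \<in> S \<inter> cball a r\<close> by (meson less_imp_le order_trans)
  next
    case False
    then show ?thesis
      using x(2) that by (simp add: dist_norm norm_minus_commute)
  qed
  then show ?thesis
    using x(1) by (auto simp: is_arg_min_def not_less)
qed

lemma line_minimum_grad_orthogonal: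
  assumes "GDERIV f x :> D" "\<And>t. f x \<le> f (x + t *\<^sub>R h)"
  shows "D \<bullet> h = 0"
proof -
  have "((\<lambda>t. f (x + t *\<^sub>R h)) has_real_derivative D \<bullet> h) (at 0)"
    by (rule GDERIV_line) (use assms(1) in simp)
  then show ?thesis
    by (rule DERIV_local_min[where d = 1]) (use assms(2) in auto)
qed

section \<open>Accelerated gradient descent\<close>

text \<open>
  With \<open>v\<^sub>k = y\<^sub>k\<^sub>-\<^sub>1 + (y\<^sub>k - y\<^sub>k\<^sub>-\<^sub>1) / \<alpha>\<close> and \<open>\<alpha> = sqrt (\<mu> / L)\<close>, the potential
  \<open>f y\<^sub>k - f y\<^sub>* + \<mu> / 2 * (norm (v\<^sub>k - y\<^sub>*))\<^sup>2\<close> shrinks by the factor \<open>1 - \<alpha>\<close> in every step.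
\<close>

lemma agd_potential_step:
  fixes y y' ys :: "'a::real_inner"
  assumes sc: "sc_smooth \<mu> L f g" and \<alpha>: "0 < \<alpha>" "\<alpha> \<le> 1" and \<mu>: "0 < \<mu>" "\<mu> = \<alpha>\<^sup>2 * L"
  defines "z \<equiv> y + ((1 - \<alpha>) / (1 + \<alpha>)) *\<^sub>R (y - y')"
  defines "y1 \<equiv> z - (1 / L) *\<^sub>R g z"
  shows "f y1 - f ys + \<mu> / 2 * (norm (y + (1 / \<alpha>) *\<^sub>R (y1 - y) - ys))\<^sup>2
    \<le> (1 - \<alpha>) * (f y - f ys + \<mu> / 2 * (norm (y' + (1 / \<alpha>) *\<^sub>R (y - y') - ys))\<^sup>2)"
proof -
  have L: "0 < L"
    using \<mu> \<alpha> by (metis zero_less_mult_pos zero_less_power)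
  define v where "v = y' + (1 / \<alpha>) *\<^sub>R (y - y')"
  \<comment> \<open>The weighted mean of \<open>v\<close> and \<open>z\<close>, seen from
    \<open>ys\<close>; a gradient step of length \<open>\<alpha> / \<mu>\<close> from it leads to
    the next \<open>v\<close>, as \<open>v1\<close> shows.\<close>
  define w where "w = (1 - \<alpha>) *\<^sub>R (v - ys) + \<alpha> *\<^sub>R (z - ys)"
  have v: "\<alpha> *\<^sub>R v = (1 + \<alpha>) *\<^sub>R z - y"
  proof -
    have "(1 + \<alpha>) *\<^sub>R z = (1 + \<alpha>) *\<^sub>R y + (1 - \<alpha>) *\<^sub>R (y - y')"
      using \<alpha> by (simp add: z_def scaleR_add_right)
    moreover have "\<alpha> *\<^sub>R v = \<alpha> *\<^sub>R y' + (y - y')"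
      using \<alpha> by (simp add: v_def scaleR_add_right)
    ultimately have "(1 + \<alpha>) *\<^sub>R z = y + \<alpha> *\<^sub>R v"
      by (simp only:) (simp add: algebra_simps)
    then show ?thesis
      by simp
  qed
  have w: "\<alpha> *\<^sub>R w = z - (1 - \<alpha>) *\<^sub>R y - \<alpha> *\<^sub>R ys"
  proof -
    have "\<alpha> *\<^sub>R w = (1 - \<alpha>) *\<^sub>R (\<alpha> *\<^sub>R v) + (\<alpha>\<^sup>2) *\<^sub>R z - \<alpha> *\<^sub>R ys"
      by (simp add: w_def algebra_simps power2_eq_square)
    then show ?thesis
      unfolding v by (simp add: algebra_simps power2_eq_square)
  qed
  have v1: "y + (1 / \<alpha>) *\<^sub>R (y1 - y) - ys = w - (\<alpha> / \<mu>) *\<^sub>R g z"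
  proof -
    have "\<alpha> *\<^sub>R (y + (1 / \<alpha>) *\<^sub>R (y1 - y) - ys) = \<alpha> *\<^sub>R y + (y1 - y) - \<alpha> *\<^sub>R ys"
      using \<alpha> by (simp add: algebra_simps)
    also have "\<dots> = \<alpha> *\<^sub>R w - (1 / L) *\<^sub>R g z"
      unfolding w y1_def by (simp add: algebra_simps)
    also have "\<dots> = \<alpha> *\<^sub>R (w - (\<alpha> / \<mu>) *\<^sub>R g z)"
      using \<alpha> L by (simp add: \<mu>(2) algebra_simps power2_eq_square)
    finally show ?thesis
      using \<alpha> by simp
  qed
  \<comment> \<open>Convexity of the squared norm, with the defect written out.\<close>
  have w_sq: "(norm w)\<^sup>2 \<le> (1 - \<alpha>) * (norm (v - ys))\<^sup>2 + \<alpha> * (norm (z - ys))\<^sup>2"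
  proof -
    have "(1 - \<alpha>) * (norm (v - ys))\<^sup>2 + \<alpha> * (norm (z - ys))\<^sup>2 - (norm w)\<^sup>2 =
        \<alpha> * (1 - \<alpha>) * (norm ((v - ys) - (z - ys)))\<^sup>2"
      unfolding w_def power2_norm_eq_inner
      by (simp add: inner_add_left inner_add_right inner_diff_left inner_diff_right inner_commute)
        (simp add: algebra_simps inner_commute)
    moreover have "0 \<le> \<alpha> * (1 - \<alpha>) * (norm ((v - ys) - (z - ys)))\<^sup>2"
      using \<alpha> by simp
    ultimately show ?thesis
      by linarith
  qed
  have sq: "\<mu> / 2 * (norm (w - (\<alpha> / \<mu>) *\<^sub>R g z))\<^sup>2 =
      \<mu> / 2 * (norm w)\<^sup>2 - \<alpha> * (g z \<bullet> w) + (norm (g z))\<^sup>2 / (2 * L)"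
  proof -
    have "(norm (w - (\<alpha> / \<mu>) *\<^sub>R g z))\<^sup>2 =
        (norm w)\<^sup>2 - 2 * (\<alpha> / \<mu>) * (g z \<bullet> w) + (\<alpha> / \<mu>)\<^sup>2 * (norm (g z))\<^sup>2"
      unfolding power2_norm_eq_inner
      by (simp add: inner_diff_left inner_diff_right inner_commute power2_eq_square)
    moreover have "\<mu> / 2 * (2 * (\<alpha> / \<mu>)) = \<alpha>" "\<mu> / 2 * (\<alpha> / \<mu>)\<^sup>2 = 1 / (2 * L)"
      using \<alpha> L \<mu> by (simp_all add: field_simps power2_eq_square)
    moreover have "\<mu> / 2 * ((norm w)\<^sup>2 - 2 * (\<alpha> / \<mu>) * (g z \<bullet> w) + (\<alpha> / \<mu>)\<^sup>2 * (norm (g z))\<^sup>2) =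
        \<mu> / 2 * (norm w)\<^sup>2 - \<mu> / 2 * (2 * (\<alpha> / \<mu>)) * (g z \<bullet> w)
        + \<mu> / 2 * (\<alpha> / \<mu>)\<^sup>2 * (norm (g z))\<^sup>2"
      by (simp only: distrib_left right_diff_distrib mult.assoc)
    ultimately show ?thesis
      by simp
  qed
  have y1: "f y1 \<le> f z - (norm (g z))\<^sup>2 / (2 * L)"
  proof -
    have "f y1 \<le> f z + g z \<bullet> (- (1 / L) *\<^sub>R g z) + L / 2 * (norm ((1 / L) *\<^sub>R g z))\<^sup>2"
      using sc_smoothD(5)[OF sc, of y1 z] by (simp add: y1_def)
    also have "\<dots> = f z - (norm (g z))\<^sup>2 / (2 * L)"
      using L by (simp add: power_divide power2_norm_eq_inner[symmetric]) (simp add: field_simps power2_eq_square)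
    finally show ?thesis .
  qed
  have "f z + g z \<bullet> (y - z) \<le> f y"
    using sc_smoothD(4)[OF sc, of z y] \<mu>(1) by (smt (verit) divide_nonneg_pos mult_nonneg_nonneg zero_le_power2)
  moreover have "f z + g z \<bullet> (ys - z) + \<mu> / 2 * (norm (z - ys))\<^sup>2 \<le> f ys"
    using sc_smoothD(4)[OF sc, of z ys] by (simp add: norm_minus_commute)
  \<comment> \<open>The linear terms of the two lower bounds combine to
    \<open>- \<alpha> * (g z \<bullet> w)\<close>, which is the cross term in \<open>sq\<close>; the
    squared gradients in \<open>sq\<close> and \<open>y1\<close> cancel.\<close>
  ultimately have "(1 - \<alpha>) * (f z + g z \<bullet> (y - z))
      + \<alpha> * (f z + g z \<bullet> (ys - z) + \<mu> / 2 * (norm (z - ys))\<^sup>2)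
      \<le> (1 - \<alpha>) * f y + \<alpha> * f ys"
    using \<alpha> by (intro add_mono mult_left_mono) auto
  moreover have "(1 - \<alpha>) * (g z \<bullet> (y - z)) + \<alpha> * (g z \<bullet> (ys - z)) = - \<alpha> * (g z \<bullet> w)"
  proof -
    have "(1 - \<alpha>) *\<^sub>R (y - z) + \<alpha> *\<^sub>R (ys - z) = - (\<alpha> *\<^sub>R w)"
      unfolding w by (simp add: algebra_simps)
    then have "g z \<bullet> ((1 - \<alpha>) *\<^sub>R (y - z) + \<alpha> *\<^sub>R (ys - z)) = g z \<bullet> (- (\<alpha> *\<^sub>R w))"
      by simp
    then show ?thesis
      by (simp add: inner_add_right)
  qed
  ultimately have key: "f z - \<alpha> * (g z \<bullet> w) + \<alpha> * (\<mu> / 2 * (norm (z - ys))\<^sup>2)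
      \<le> (1 - \<alpha>) * f y + \<alpha> * f ys"
    by (simp add: algebra_simps)
  have "\<mu> / 2 * (norm w)\<^sup>2 \<le> \<mu> / 2 * ((1 - \<alpha>) * (norm (v - ys))\<^sup>2 + \<alpha> * (norm (z - ys))\<^sup>2)"
    using w_sq \<mu>(1) by (intro mult_left_mono) auto
  then show ?thesis
    unfolding v1 sq v_def[symmetric] using y1 key by (simp add: algebra_simps diff_divide_distrib)
qed

text \<open>The stopping test looks at the gradient, so the decay of the potential is converted by
  \<open>grad_norm_sq_le\<close>. Since both components of the initial state are \<open>y0\<close>,
  the initial potential involves only the distance of \<open>y0\<close> to the minimiser.\<close>

lemma agd_rate:
  fixes y0 ys :: "'a::real_inner"
  assumes sc: "sc_smooth \<mu> L f g" and \<mu>: "0 < \<mu>" "\<mu> \<le> L" and ys: "g ys = 0"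
  shows "(norm (g (agd_iterate f L \<mu> y0 k)))\<^sup>2
    \<le> 2 * L\<^sup>2 * (1 - sqrt (\<mu> / L)) ^ k * (norm (y0 - ys))\<^sup>2"
proof -
  define \<alpha> where "\<alpha> = sqrt (\<mu> / L)"
  have \<alpha>: "0 < \<alpha>" "\<alpha> \<le> 1" "\<mu> = \<alpha>\<^sup>2 * L"
    using \<mu> by (auto simp: \<alpha>_def)
  have ys_min: "f ys \<le> f y" for y
    using sc_smoothD(4)[OF sc, of ys y] ys \<mu>(1) by (smt (verit) divide_nonneg_pos inner_zero_left mult_nonneg_nonneg zero_le_power2)
  have \<theta>: "(sqrt (L / \<mu>) - 1) / (sqrt (L / \<mu>) + 1) = (1 - \<alpha>) / (1 + \<alpha>)"
  proof -
    have "sqrt (L / \<mu>) = 1 / \<alpha>"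
      by (simp add: \<alpha>_def real_sqrt_divide)
    moreover have "1 / \<alpha> - 1 = (1 - \<alpha>) / \<alpha>" "1 / \<alpha> + 1 = (1 + \<alpha>) / \<alpha>"
      using \<alpha>(1) by (simp_all add: field_simps)
    ultimately show ?thesis
      using \<alpha>(1) by simp
  qed
  define V where "V = (\<lambda>(y, y'). f y - f ys + \<mu> / 2 * (norm (y' + (1 / \<alpha>) *\<^sub>R (y - y') - ys))\<^sup>2)"
  have V: "V (agd_state f L \<mu> y0 k) \<le> (1 - \<alpha>) ^ k * V (y0, y0)" for k
  proof (induction k)
    case (Suc k)
    obtain y y' where st: "agd_state f L \<mu> y0 k = (y, y')"
      by fastforce
    have "V (agd_state f L \<mu> y0 (Suc k)) \<le> (1 - \<alpha>) * V (y, y')"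
      using agd_potential_step[OF sc \<alpha>(1,2) \<mu>(1) \<alpha>(3), of y y' ys]
      by (simp add: V_def st Let_def \<theta> sc_smoothD(2)[OF sc])
    also have "\<dots> \<le> (1 - \<alpha>) * ((1 - \<alpha>) ^ k * V (y0, y0))"
      using Suc.IH st \<alpha> by (intro mult_left_mono) auto
    finally show ?case
      by simp
  qed simp
  have "V (y0, y0) \<le> L * (norm (y0 - ys))\<^sup>2"
  proof -
    have "f y0 - f ys \<le> L / 2 * (norm (y0 - ys))\<^sup>2"
      using sc_smoothD(5)[OF sc, of y0 ys] ys by simp
    moreover have "\<mu> / 2 * (norm (y0 - ys))\<^sup>2 \<le> L / 2 * (norm (y0 - ys))\<^sup>2"
      using \<mu> by (intro mult_right_mono) auto
    ultimately show ?thesis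
      by (simp add: V_def)
  qed
  then have "(1 - \<alpha>) ^ k * V (y0, y0) \<le> (1 - \<alpha>) ^ k * (L * (norm (y0 - ys))\<^sup>2)"
    using \<alpha> by (intro mult_left_mono) auto
  moreover have "f (agd_iterate f L \<mu> y0 k) - f ys \<le> V (agd_state f L \<mu> y0 k)"
    using \<mu>(1) by (simp add: V_def agd_iterate_def case_prod_beta)
  ultimately have "f (agd_iterate f L \<mu> y0 k) - f ys \<le> (1 - \<alpha>) ^ k * (L * (norm (y0 - ys))\<^sup>2)"
    using V[of k] by linarith
  then have "2 * L * (f (agd_iterate f L \<mu> y0 k) - f ys)
      \<le> 2 * L * ((1 - \<alpha>) ^ k * (L * (norm (y0 - ys))\<^sup>2))"
    using \<mu> by (intro mult_left_mono) auto
  moreover have "(norm (g (agd_iterate f L \<mu> y0 k)))\<^sup>2 \<le> 2 * L * (f (agd_iterate f L \<mu> y0 k) - f ys)"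
    using \<mu> by (intro grad_norm_sq_le[OF sc]) (auto intro: ys_min)
  ultimately show ?thesis
    by (simp add: \<alpha>_def power2_eq_square mult_ac)
qed

text \<open>Only the ratio \<open>B\<close> of initial distance to tolerance enters the count. A
  warm start that keeps this ratio fixed makes all inner runs equally long, however small
  \<open>\<delta>\<close> becomes.\<close>

lemma agd_terminates:
  fixes y0 ys :: "'a::real_inner"
  assumes sc: "sc_smooth \<mu> L f g" and \<mu>: "0 < \<mu>" "\<mu> \<le> L" and ys: "g ys = 0"
    and \<delta>: "0 < \<delta>" "norm (y0 - ys) \<le> B * \<delta>"
    and \<Lambda>: "0 \<le> \<Lambda>" "2 * (L / \<mu>)\<^sup>2 * B\<^sup>2 \<le> exp \<Lambda>"
  shows "\<exists>y N. agd f L \<mu> y0 \<delta> y N \<and> norm (y - ys) \<le> \<delta> \<and> real N \<le> sqrt (L / \<mu>) * \<Lambda> + 2"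
proof -
  define stop where "stop k \<longleftrightarrow> k \<ge> 1 \<and> norm (g (agd_iterate f L \<mu> y0 k)) \<le> \<mu> * \<delta>" for k
  \<comment> \<open>The added \<open>1\<close> secures \<open>k \<ge> 1\<close>, which the stopping
    test demands, even when \<open>\<Lambda> = 0\<close>; together with the rounding it accounts for
    the \<open>2\<close> in the bound.\<close>
  define k where "k = nat \<lceil>sqrt (L / \<mu>) * \<Lambda>\<rceil> + 1"
  have k: "sqrt (L / \<mu>) * \<Lambda> \<le> real k" "real k \<le> sqrt (L / \<mu>) * \<Lambda> + 2"
    using of_int_ceiling_le_add_one[of "sqrt (L / \<mu>) * \<Lambda>"] \<mu> \<Lambda>(1) unfolding k_def
    by (simp_all add: of_nat_nat) linarith+
  define \<alpha> where "\<alpha> = sqrt (\<mu> / L)"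
  have \<alpha>: "0 < \<alpha>" "\<alpha> \<le> 1"
    using \<mu> by (auto simp: \<alpha>_def)
  have "(1 - \<alpha>) ^ k \<le> exp (- \<alpha>) ^ k"
    using \<alpha> exp_ge_add_one_self[of "- \<alpha>"] by (intro power_mono) auto
  also have "\<dots> = exp (- (\<alpha> * k))"
    by (simp add: exp_of_nat_mult[symmetric] mult.commute)
  also have "\<dots> \<le> exp (- \<Lambda>)"
  proof -
    have "\<alpha> * (sqrt (L / \<mu>) * \<Lambda>) = \<Lambda>"
      using \<mu> by (simp add: \<alpha>_def real_sqrt_divide)
    then show ?thesis
      using mult_left_mono[OF k(1), of \<alpha>] \<alpha>(1) by (simp only: exp_le_cancel_iff neg_le_iff_le less_imp_le)
  qed
  finally have pow: "(1 - \<alpha>) ^ k \<le> exp (- \<Lambda>)" .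
  have "0 \<le> B * \<delta>"
    using \<delta>(2) norm_ge_zero order_trans by blast
  have "(norm (g (agd_iterate f L \<mu> y0 k)))\<^sup>2 \<le> 2 * L\<^sup>2 * (1 - \<alpha>) ^ k * (norm (y0 - ys))\<^sup>2"
    unfolding \<alpha>_def by (rule agd_rate[OF sc \<mu> ys])
  also have "\<dots> \<le> 2 * L\<^sup>2 * exp (- \<Lambda>) * (B * \<delta>)\<^sup>2"
    using pow \<delta>(2) \<alpha> \<mu> by (intro mult_mono power_mono) auto
  also have "\<dots> = (2 * (L / \<mu>)\<^sup>2 * B\<^sup>2) * (exp (- \<Lambda>) * (\<mu> * \<delta>)\<^sup>2)"
    using \<mu> by (simp add: field_simps)
  also have "\<dots> \<le> exp \<Lambda> * (exp (- \<Lambda>) * (\<mu> * \<delta>)\<^sup>2)"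
    using \<Lambda>(2) by (intro mult_right_mono) auto
  also have "\<dots> = (\<mu> * \<delta>)\<^sup>2"
    by (simp add: exp_minus)
  finally have "norm (g (agd_iterate f L \<mu> y0 k)) \<le> \<mu> * \<delta>"
    using \<mu> \<delta> by (simp add: power2_le_iff_abs_le)
  then have "stop k"
    by (simp add: stop_def k_def)
  define N where "N = (LEAST k. stop k)"
  have N: "stop N" "N \<le> k" "\<forall>j<N. \<not> stop j"
    unfolding N_def using \<open>stop k\<close> by (auto intro: LeastI Least_le dest: not_less_Least)
  define y where "y = agd_iterate f L \<mu> y0 N"
  \<comment> \<open>The threshold \<open>\<mu> * \<delta>\<close> of the test is made for this:
    strong monotonicity turns it into distance \<open>\<delta>\<close>.\<close>
  have "\<mu> * norm (y - ys) \<le> \<mu> * \<delta>"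
    using sc_smooth_norm_le_grad[OF sc, of y ys] N(1) ys by (simp add: stop_def y_def)
  then have "norm (y - ys) \<le> \<delta>"
    using \<mu> by simp
  moreover have "agd f L \<mu> y0 \<delta> y N"
    using N(1,3) by (simp add: agd_def Let_def sc_smoothD(2)[OF sc] stop_def y_def)
  moreover have "real N \<le> sqrt (L / \<mu>) * \<Lambda> + 2"
    using N(2) k(2) by linarith
  ultimately show ?thesis
    by blast
qed

text \<open>As a simplification rule it rewrites \<open>transpose A *v y\<close> to
  \<open>y v* A\<close>, hiding the products in which everything below is phrased.\<close>

declare transpose_matrix_vector [simp del]

section \<open>The smallest nonzero singular value\<close>

lemma inner_transpose_matrix_vector:
  fixes A :: "real^'n^'m"
  shows "(transpose A *v y) \<bullet> x = y \<bullet> (A *v x)"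
  by (simp add: transpose_matrix_vector dot_lmul_matrix)

text \<open>The orthogonal complement of the range is the kernel of the transpose. Applied to
  \<open>A\<close> this normalises multipliers, applied to \<open>transpose A\<close> it splits off
  the kernel of \<open>A\<close>.\<close>

lemma range_matrix_decompose:
  fixes A :: "real^'n^'m"
  obtains y z where "y \<in> range ((*v) A)" "transpose A *v z = 0" "x = y + z"
proof -
  have sub: "subspace (range ((*v) A))"
    by (simp add: linear_subspace_image)
  obtain y z where yz: "y \<in> span (range ((*v) A))"
    "\<And>w. w \<in> span (range ((*v) A)) \<Longrightarrow> orthogonal z w" "x = y + z"
    using orthogonal_subspace_decomp_exists by blast
  have "(transpose A *v z) \<bullet> w = 0" for w
    using yz(2)[of "A *v w"] by (simp add: span_base inner_transpose_matrix_vector orthogonal_def)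
  then have "transpose A *v z = 0"
    by (metis inner_eq_zero_iff)
  then show thesis
    using that yz sub by (metis span_eq_iff)
qed

text \<open>The value \<open>0\<close> at \<open>t = 0\<close> is a minimum, so the derivative
  \<open>2 * p\<close> vanishes. This first-order condition takes the place of Lagrange multipliers
  on the sphere in the eigenvector argument below.\<close>

lemma quadratic_nonneg_imp_linear_zero:
  fixes p c :: real
  assumes "\<And>t. 0 \<le> 2 * t * p + t\<^sup>2 * c"
  shows "p = 0"
proof -
  have "((\<lambda>t. 2 * t * p + t\<^sup>2 * c) has_real_derivative 2 * p) (at 0)"
    by (auto intro!: derivative_eq_intros)
  then have "2 * p = 0"
    by (rule DERIV_local_min[where d = 1]) (use assms in auto)
  then show ?thesis
    by simp
qed

text \<open>
  A minimiser of \<open>norm (A *v v)\<close> over the unit sphere of the range of \<open>transpose A\<close> is an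
  eigenvector of \<open>transpose A ** A\<close> and realises the smallest nonzero singular value.
\<close>

lemma sigma_min_characterization:
  fixes A :: "real^'n^'m"
  assumes "A \<noteq> 0"
  shows sigma_min_pos: "0 < sigma_min A"
    and sigma_min_le_norm: "v \<in> range ((*v) (transpose A)) \<Longrightarrow> sigma_min A * norm v \<le> norm (A *v v)"
proof -
  let ?R = "range ((*v) (transpose A))"
  have sub: "subspace ?R"
    by (simp add: linear_subspace_image)
  have inj: "v = 0" if "v \<in> ?R" "A *v v = 0" for v
    using that by (metis imageE inner_eq_zero_iff inner_transpose_matrix_vector inner_zero_right)
  obtain x where "A *v x \<noteq> 0"
    using assms by (metis matrix_eq matrix_vector_mult_0)
  then obtain y where y: "y \<in> ?R" "y \<noteq> 0"
    using range_matrix_decompose[of "transpose A" x]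
    by (metis add.left_neutral transpose_transpose)
  have "(1 / norm y) *\<^sub>R y \<in> ?R \<inter> sphere 0 1"
    using y subspace_scale[OF sub] by simp
  then have "?R \<inter> sphere 0 1 \<noteq> {}"
    by blast
  moreover have "compact (?R \<inter> sphere 0 1)"
    using closed_subspace[OF sub] by (simp add: closed_Int_compact)
  moreover have "continuous_on (?R \<inter> sphere 0 1) (\<lambda>v. norm (A *v v))"
    by (intro continuous_intros linear_continuous_on) (simp add: linear_linear)
  ultimately obtain v where "v \<in> ?R \<inter> sphere 0 1"
    "\<forall>w \<in> ?R \<inter> sphere 0 1. norm (A *v v) \<le> norm (A *v w)"
    using continuous_attains_inf by metis
  then have v: "v \<in> ?R" "norm v = 1"
    and v_min: "\<And>w. w \<in> ?R \<Longrightarrow> norm w = 1 \<Longrightarrow> norm (A *v v) \<le> norm (A *v w)"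
    by simp_all
  define s where "s = norm (A *v v)"
  have s_pos: "0 < s"
    using inj[OF v(1)] v(2) by (auto simp: s_def)
  have s_le: "s * norm w \<le> norm (A *v w)" if "w \<in> ?R" for w
  proof (cases "w = 0")
    case False
    have "norm (A *v v) \<le> norm (A *v ((1 / norm w) *\<^sub>R w))"
      using False that subspace_scale[OF sub] by (intro v_min) auto
    then show ?thesis
      using False by (simp add: s_def matrix_vector_mult_scaleR field_simps)
  qed simp
  \<comment> \<open>The residual of the eigenvalue equation; it lies in \<open>?R\<close>, so it is
    an admissible direction for perturbing \<open>v\<close>.\<close>
  define u where "u = transpose A *v (A *v v) - s\<^sup>2 *\<^sub>R v"
  have u: "u \<in> ?R"
    using v(1) sub unfolding u_def by (intro subspace_diff subspace_scale) auto
  have uu: "(A *v v) \<bullet> (A *v u) - s\<^sup>2 * (v \<bullet> u) = u \<bullet> u"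
    by (simp add: u_def inner_diff_left inner_transpose_matrix_vector[symmetric])
  \<comment> \<open>The inequality \<open>s_le\<close> at \<open>v + t *\<^sub>R u\<close> is an
    equality for \<open>t = 0\<close>, and its linear coefficient in \<open>t\<close> is twice
    \<open>u \<bullet> u\<close>.\<close>
  have "u \<bullet> u = 0"
  proof (rule quadratic_nonneg_imp_linear_zero)
    fix t
    have "(s * norm (v + t *\<^sub>R u))\<^sup>2 \<le> (norm (A *v (v + t *\<^sub>R u)))\<^sup>2"
      using s_pos u v sub by (intro power_mono s_le subspace_add subspace_scale) auto
    moreover have "(norm (A *v (v + t *\<^sub>R u)))\<^sup>2 =
        s\<^sup>2 + 2 * t * ((A *v v) \<bullet> (A *v u)) + t\<^sup>2 * (norm (A *v u))\<^sup>2"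
      unfolding s_def power2_norm_eq_inner matrix_vector_right_distrib matrix_vector_mult_scaleR
        inner_add_left inner_add_right by (simp add: inner_commute power2_eq_square)
    moreover have "(norm (v + t *\<^sub>R u))\<^sup>2 = 1 + 2 * t * (v \<bullet> u) + t\<^sup>2 * (norm u)\<^sup>2"
      using v(2) unfolding power2_norm_eq_inner inner_add_left inner_add_right norm_eq_1
      by (simp add: inner_commute power2_eq_square)
    ultimately show "0 \<le> 2 * t * (u \<bullet> u) + t\<^sup>2 * ((norm (A *v u))\<^sup>2 - s\<^sup>2 * (norm u)\<^sup>2)"
      unfolding uu[symmetric] by (simp add: power_mult_distrib algebra_simps)
  qed
  then have "transpose A *v (A *v v) = s\<^sup>2 *\<^sub>R v"
    by (simp add: u_def)
  then have "singular_value A s"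
    using v(2) s_pos unfolding singular_value_def
    by (intro conjI exI[of _ v]) (auto simp: matrix_vector_mul_assoc)
  moreover have "s \<le> s'" if s': "singular_value A s'" "s' \<noteq> 0" for s'
  proof -
    obtain w where w: "w \<noteq> 0" "transpose A *v (A *v w) = s'\<^sup>2 *\<^sub>R w" "0 \<le> s'"
      using s' unfolding singular_value_def by (auto simp: matrix_vector_mul_assoc)
    \<comment> \<open>An eigenvector for a nonzero value lies in the range of
      \<open>transpose A\<close>, where \<open>s_le\<close> holds.\<close>
    then have "w = transpose A *v ((1 / s'\<^sup>2) *\<^sub>R (A *v w))"
      using s' by (simp add: matrix_vector_mult_scaleR)
    then have "s * norm w \<le> norm (A *v w)"
      by (intro s_le) blast
    moreover have "(norm (A *v w))\<^sup>2 = (s' * norm w)\<^sup>2"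
      using inner_transpose_matrix_vector[of A "A *v w" w] w(2)
      by (simp add: power2_norm_eq_inner[symmetric] power_mult_distrib)
    then have "norm (A *v w) = s' * norm w"
      using w(3) by (simp add: power2_eq_iff_nonneg)
    ultimately show ?thesis
      using w(1) by simp
  qed
  ultimately have "sigma_min A = s"
    unfolding sigma_min_def using s_pos by (intro cInf_eq_minimum) auto
  then show "0 < sigma_min A" "v \<in> ?R \<Longrightarrow> sigma_min A * norm v \<le> norm (A *v v)" for v
    using s_pos s_le by auto
qed

lemma norm_matrix_vector_le:
  fixes A :: "real^'n^'m"
  assumes "onorm ((*v) A) \<le> c"
  shows "norm (A *v x) \<le> c * norm x"
  using onorm[of "(*v) A" x] assms
  by (meson matrix_vector_mul_bounded_linear mult_right_mono norm_ge_zero order_trans)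

lemma norm_transpose_le:
  fixes A :: "real^'n^'m"
  assumes "onorm ((*v) A) \<le> c"
  shows "norm (transpose A *v w) \<le> c * norm w"
proof (cases "transpose A *v w = 0")
  case True
  have "0 \<le> c"
    using onorm_pos_le[of "(*v) A"] assms by (simp add: matrix_vector_mul_bounded_linear)
  then show ?thesis
    using True by simp
next
  case False
  let ?u = "transpose A *v w"
  have "norm ?u * norm ?u = w \<bullet> (A *v ?u)"
    by (simp add: inner_transpose_matrix_vector[symmetric] power2_norm_eq_inner[symmetric] power2_eq_square)
  also have "\<dots> \<le> norm w * (c * norm ?u)"
    by (rule order_trans[OF norm_cauchy_schwarz])
      (intro mult_left_mono norm_matrix_vector_le assms, simp)
  finally show ?thesis
    using False by (simp add: mult.left_commute mult.commute[of _ c])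
qed

text \<open>Passing from \<open>A\<close> to its transpose keeps the constant:
  \<open>w = A *v y\<close> with \<open>y\<close> in the range of \<open>transpose A\<close>, and
  the pairing of \<open>y\<close> with \<open>transpose A *v w\<close> is the squared norm of
  \<open>w\<close>.\<close>

lemma sigma_min_le_norm_transpose:
  fixes A :: "real^'n^'m"
  assumes "A \<noteq> 0" "w \<in> range ((*v) A)"
  shows "sigma_min A * norm w \<le> norm (transpose A *v w)"
proof (cases "w = 0")
  case False
  obtain x where x: "w = A *v x"
    using assms by auto
  obtain y z where yz: "y \<in> range ((*v) (transpose A))" "A *v z = 0" "x = y + z"
    using range_matrix_decompose[of "transpose A" x] by auto
  then have w: "w = A *v y"
    by (simp add: x matrix_vector_right_distrib)
  have "sigma_min A * (norm w * norm w) = sigma_min A * (y \<bullet> (transpose A *v w))"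
    unfolding inner_commute[of y] inner_transpose_matrix_vector
    by (simp add: w power2_norm_eq_inner[symmetric] power2_eq_square)
  also have "\<dots> \<le> sigma_min A * (norm y * norm (transpose A *v w))"
    using sigma_min_pos[OF assms(1)] by (intro mult_left_mono norm_cauchy_schwarz) auto
  also have "\<dots> \<le> norm w * norm (transpose A *v w)"
    unfolding mult.assoc[symmetric]
    using sigma_min_le_norm[OF assms(1) yz(1)] w by (intro mult_right_mono) auto
  finally show ?thesis
    using False by (simp add: mult.left_commute)
qed simp

lemma sigma_min_le_bound:
  fixes A :: "real^'n^'m"
  assumes "A \<noteq> 0" "onorm ((*v) A) \<le> c"
  shows "sigma_min A \<le> c"
proof -
  obtain x where "A *v x \<noteq> 0"
    using assms(1) by (metis matrix_eq matrix_vector_mult_0)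
  then obtain w where w: "w \<in> range ((*v) A)" "w \<noteq> 0"
    by blast
  then have "sigma_min A * norm w \<le> c * norm w"
    using sigma_min_le_norm_transpose[OF assms(1) w(1)] norm_transpose_le[OF assms(2), of w]
    by linarith
  then show ?thesis
    using w(2) by simp
qed

section \<open>Multipliers and dual solutions\<close>

lemma optimal_solution_grad_orthogonal:
  fixes A :: "real^'n^'m"
  assumes "optimal_solution f (feasible A b) xs" "GDERIV f xs :> D" "A *v h = 0"
  shows "D \<bullet> h = 0"
proof (rule line_minimum_grad_orthogonal[OF assms(2)])
  fix t
  have "xs + t *\<^sub>R h \<in> feasible A b"
    using assms(1,3) by (simp add: is_arg_min_def feasible_def matrix_vector_right_distrib matrix_vector_mult_scaleR)
  then show "f xs \<le> f (xs + t *\<^sub>R h)"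
    using assms(1) unfolding is_arg_min_def by (meson not_less)
qed

text \<open>The gradient is orthogonal to the kernel of \<open>A\<close>, hence equals some
  \<open>transpose A *v w\<close>. Such \<open>w\<close> need not be unique; removing its part in
  the kernel of the transpose leaves the multiplier that the algorithm approaches.\<close>

lemma multiplier_exists:
  fixes A :: "real^'n^'m"
  assumes "optimal_solution f (feasible A b) xs" "GDERIV f xs :> D"
  obtains l where "l \<in> range ((*v) A)" "D + transpose A *v l = 0"
proof -
  obtain y z where yz: "y \<in> range ((*v) (transpose A))" "A *v z = 0" "D = y + z"
    using range_matrix_decompose[of "transpose A" D] by auto
  have "y \<bullet> z = 0"
    using yz(1,2) by (auto simp: inner_transpose_matrix_vector)
  then have "z = 0"
    using optimal_solution_grad_orthogonal[OF assms yz(2)] by (simp add: yz(3) inner_add_left)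
  then obtain w where w: "D = transpose A *v w"
    using yz by auto
  obtain y' z' where yz': "y' \<in> range ((*v) A)" "transpose A *v z' = 0" "w = y' + z'"
    using range_matrix_decompose[of A w] by auto
  show thesis
  proof (rule that[of "- y'"])
    show "- y' \<in> range ((*v) A)"
      using yz'(1) linear_subspace_image[of "(*v) A" UNIV] by (simp add: subspace_neg)
    show "D + transpose A *v - y' = 0"
      using w yz' by (simp add: matrix_vector_right_distrib linear_neg)
  qed
qed

text \<open>Since the dual iteration starts at \<open>0\<close>, the right-hand side is the initial
  distance to the dual solutions. Every dual solution is a multiplier, so it differs from
  \<open>l\<close> by an element of the kernel of the transpose. That kernel is orthogonal to the
  range of \<open>A\<close>, which makes \<open>l\<close> the shortest of them.\<close>

lemma multiplier_norm_le_infdist: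
  fixes A :: "real^'n^'m"
  assumes sc: "sc_smooth \<mu> L f g" "0 \<le> \<mu>" and xs: "optimal_solution f (feasible A b) xs"
    and l: "l \<in> range ((*v) A)" "g xs + transpose A *v l = 0"
  shows "norm l \<le> infdist 0 (dual_solutions A b f)"
proof -
  have Axs: "A *v xs = b"
    using xs by (simp add: is_arg_min_def feasible_def)
  have le: "dual_fun A b f l' \<le> ereal (f xs)" for l'
    unfolding dual_fun_def by (rule INF_lower2[of xs]) (auto simp: Axs)
  have ge: "ereal (f xs) \<le> dual_fun A b f l"
    unfolding dual_fun_def
  proof (rule INF_greatest)
    fix x
    have "g xs \<bullet> (x - xs) = - (l \<bullet> (A *v x - b))"
    proof -
      have "g xs = - (transpose A *v l)"
        using l(2) by (simp add: eq_neg_iff_add_eq_0)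
      then show ?thesis
        by (simp add: inner_transpose_matrix_vector matrix_vector_mult_diff_distrib Axs)
    qed
    moreover have "0 \<le> \<mu> / 2 * (norm (x - xs))\<^sup>2"
      using sc(2) by simp
    ultimately have "f xs \<le> f x + l \<bullet> (A *v x - b)"
      using sc_smoothD(4)[OF sc(1), of xs x] by linarith
    then show "ereal (f xs) \<le> ereal (f x + l \<bullet> (A *v x - b))"
      by simp
  qed
  \<comment> \<open>Nonemptiness matters, because \<open>infdist\<close> to the empty set is
    \<open>0\<close>.\<close>
  have "l \<in> dual_solutions A b f"
    using le ge by (auto simp: dual_solutions_def is_arg_max_def not_less intro: order_trans)
  moreover have "norm l \<le> norm l'" if "l' \<in> dual_solutions A b f" for l'
  proof -
    have "dual_fun A b f l \<le> dual_fun A b f l'"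
      using that by (auto simp: dual_solutions_def is_arg_max_def not_less)
    with ge have "ereal (f xs) \<le> dual_fun A b f l'"
      by (rule order_trans)
    also have "dual_fun A b f l' \<le> ereal (f x + l' \<bullet> (A *v x - b))" for x
      unfolding dual_fun_def by (rule INF_lower) simp
    finally have min: "f xs \<le> f x + l' \<bullet> (A *v x - b)" for x
      by simp
    \<comment> \<open>By \<open>min\<close> the Lagrangian at \<open>l'\<close> is minimal at
      \<open>xs\<close>, so its gradient vanishes there.\<close>
    have "g xs + transpose A *v l' = 0"
    proof -
      define D where "D = g xs + transpose A *v l'"
      have "GDERIV (\<lambda>x. f x + l' \<bullet> (A *v x - b)) xs :> D"
      proof -
        have "((\<lambda>x. A *v x) has_derivative (\<lambda>h. A *v h)) (at xs)"
          by (intro bounded_linear_imp_has_derivative matrix_vector_mul_bounded_linear)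
        then have "((\<lambda>x. l' \<bullet> (A *v x - b)) has_derivative (\<lambda>h. l' \<bullet> (A *v h))) (at xs)"
          by (auto intro!: derivative_eq_intros)
        then have "GDERIV (\<lambda>x. l' \<bullet> (A *v x - b)) xs :> transpose A *v l'"
          by (simp add: gderiv_def inner_commute[of _ "transpose A *v l'"] inner_transpose_matrix_vector)
        then show ?thesis
          unfolding D_def by (intro GDERIV_add sc_smoothD(1)[OF sc(1)])
      qed
      then have "D \<bullet> D = 0"
        by (rule line_minimum_grad_orthogonal) (use min in \<open>simp add: Axs\<close>)
      then show ?thesis
        by (simp add: D_def)
    qed
    then have "transpose A *v (l' - l) = 0"
      using l(2) by (simp add: matrix_vector_mult_diff_distrib) (metis add_left_cancel)
    moreover obtain x where "l = A *v x"
      using l(1) by auto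
    ultimately have "(l' - l) \<bullet> l = 0"
      by (metis inner_transpose_matrix_vector inner_zero_left)
    then have "l \<bullet> l = l' \<bullet> l"
      by (simp add: inner_diff_left)
    then have "norm l * norm l \<le> norm l' * norm l"
      using norm_cauchy_schwarz[of l' l]
      by (simp add: power2_norm_eq_inner[symmetric] power2_eq_square)
    then show ?thesis
      by (cases "l = 0") auto
  qed
  ultimately show ?thesis
    by (subst infdist_notempty) (auto intro!: cINF_greatest)
qed

section \<open>The inexact proximal point algorithm\<close>

text \<open>Completing the square in \<open>l\<close> shows that the supremum is attained at
  \<open>l0 + (1 / ell) *\<^sub>R (A *v x - b)\<close>, the multiplier update. What remains is the
  augmented Lagrangian with penalty \<open>1 / ell\<close>.\<close>

lemma ippa_objective_eq:
  fixes A :: "real^'n^'m"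
  assumes "0 < ell"
  shows "ippa_objective A b \<phi> ell l0 x = \<phi> x + l0 \<bullet> (A *v x - b) + (norm (A *v x - b))\<^sup>2 / (2 * ell)"
proof -
  define c where "c = A *v x - b"
  have eq: "l \<bullet> c - ell / 2 * (norm (l - l0))\<^sup>2 =
      l0 \<bullet> c + (norm c)\<^sup>2 / (2 * ell) - ell / 2 * (norm (l - (l0 + (1 / ell) *\<^sub>R c)))\<^sup>2" for l
  proof -
    have "(norm (l - (l0 + (1 / ell) *\<^sub>R c)))\<^sup>2 =
        (norm (l - l0))\<^sup>2 - 2 / ell * ((l - l0) \<bullet> c) + (norm c)\<^sup>2 / ell\<^sup>2"
      unfolding diff_diff_eq[symmetric] power2_norm_eq_inner
      by (simp add: inner_diff_left[of "l - l0"] inner_diff_right[of _ "l - l0"] inner_commute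
          power2_eq_square)
    then show ?thesis
      using assms by (simp add: field_simps power2_eq_square inner_diff_left)
  qed
  have "(SUP l. l \<bullet> c - ell / 2 * (norm (l - l0))\<^sup>2) = l0 \<bullet> c + (norm c)\<^sup>2 / (2 * ell)"
  proof (rule cSup_eq_maximum)
    show "l0 \<bullet> c + (norm c)\<^sup>2 / (2 * ell) \<in> range (\<lambda>l. l \<bullet> c - ell / 2 * (norm (l - l0))\<^sup>2)"
      unfolding eq by (rule image_eqI[of _ _ "l0 + (1 / ell) *\<^sub>R c"]) auto
    show "v \<le> l0 \<bullet> c + (norm c)\<^sup>2 / (2 * ell)"
      if "v \<in> range (\<lambda>l. l \<bullet> c - ell / 2 * (norm (l - l0))\<^sup>2)" for v
      using that assms unfolding eq by auto
  qed
  then show ?thesis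
    by (simp add: ippa_objective_def c_def)
qed

text \<open>The gradient is that of the Lagrangian at the updated multiplier. An exact minimiser
  together with its update is therefore stationary for the Lagrangian, which is how the proximal
  step is analysed.\<close>

lemma sc_smooth_ippa_objective:
  fixes A :: "real^'n^'m"
  assumes sc: "sc_smooth \<mu> L \<phi> g" and A: "onorm ((*v) A) \<le> L_A" and ell: "0 < ell"
  shows "sc_smooth \<mu> (L + L_A\<^sup>2 / ell) (ippa_objective A b \<phi> ell l0)
    (\<lambda>x. g x + transpose A *v (l0 + (1 / ell) *\<^sub>R (A *v x - b)))"
proof -
  let ?h = "\<lambda>x. l0 \<bullet> (A *v x - b) + (norm (A *v x - b))\<^sup>2 / (2 * ell)"
  let ?D = "\<lambda>x. transpose A *v (l0 + (1 / ell) *\<^sub>R (A *v x - b))"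
  have L_A: "0 \<le> L_A"
    using onorm_pos_le[of "(*v) A"] A by (simp add: matrix_vector_mul_bounded_linear)
  have inner_D: "?D x \<bullet> d = l0 \<bullet> (A *v d) + ((A *v x - b) \<bullet> (A *v d)) / ell" for x d
    by (simp add: inner_transpose_matrix_vector inner_add_left)
  have "((\<lambda>x. A *v x) has_derivative (\<lambda>h. A *v h)) (at x)" for x
    by (intro bounded_linear_imp_has_derivative matrix_vector_mul_bounded_linear)
  then have "GDERIV ?h x :> ?D x" for x
    unfolding gderiv_def inner_commute[of _ "?D x"] inner_D power2_norm_eq_inner
    using ell by (auto intro!: derivative_eq_intros simp: inner_commute field_simps)
  moreover have "norm (?D x - ?D y) \<le> L_A\<^sup>2 / ell * norm (x - y)" for x y
  proof -
    have "?D x - ?D y = transpose A *v ((1 / ell) *\<^sub>R (A *v (x - y)))"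
      unfolding matrix_vector_mult_diff_distrib[symmetric]
      by (simp add: matrix_vector_mult_diff_distrib scaleR_right_diff_distrib)
    also have "norm \<dots> \<le> L_A * (1 / ell * (L_A * norm (x - y)))"
      using ell norm_matrix_vector_le[OF A, of "x - y"] L_A
      by (intro order_trans[OF norm_transpose_le[OF A]] mult_left_mono) (auto simp: divide_right_mono)
    finally show ?thesis
      by (simp add: power2_eq_square)
  qed
  moreover have "?h x + ?D x \<bullet> (y - x) \<le> ?h y" for x y
  proof -
    have "?h y - (?h x + ?D x \<bullet> (y - x)) = (norm (A *v (y - x)))\<^sup>2 / (2 * ell)"
      unfolding inner_D power2_norm_eq_inner matrix_vector_mult_diff_distrib using ell
      by (simp add: field_simps inner_diff_left inner_diff_right inner_commute)
    moreover have "0 \<le> (norm (A *v (y - x)))\<^sup>2 / (2 * ell)"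
      using ell by simp
    ultimately show ?thesis
      by linarith
  qed
  ultimately have h: "GDERIV ?h x :> ?D x" "norm (?D x - ?D y) \<le> L_A\<^sup>2 / ell * norm (x - y)"
    "?h x + ?D x \<bullet> (y - x) \<le> ?h y" for x y
    by blast+
  have obj: "ippa_objective A b \<phi> ell l0 = (\<lambda>x. \<phi> x + ?h x)"
    by (intro ext) (simp add: ippa_objective_eq[OF ell])
  show ?thesis
    unfolding sc_smooth_def obj
  proof (intro conjI allI)
    fix x y
    show "GDERIV (\<lambda>x. \<phi> x + ?h x) x :> g x + ?D x"
      by (intro GDERIV_add sc_smoothD(1)[OF sc] h)
    show "norm (g x + ?D x - (g y + ?D y)) \<le> (L + L_A\<^sup>2 / ell) * norm (x - y)"
      using norm_triangle_mono[OF sc_smoothD(3)[OF sc, of x y] h(2)[of x y]]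
      by (simp add: add_diff_add distrib_right)
    show "\<phi> x + ?h x + (g x + ?D x) \<bullet> (y - x) + \<mu> / 2 * (norm (y - x))\<^sup>2 \<le> \<phi> y + ?h y"
      using sc_smoothD(4)[OF sc, of x y] h(3)[of x y] unfolding inner_add_left[of "g x"] by linarith
  qed
qed

text \<open>Cocoercivity pairs the gradient difference with \<open>x - xs\<close>, hence the new
  dual error with the residual \<open>A *v x - b\<close>, and the residual is \<open>ell\<close>
  times the move of the multiplier. For general \<open>ell\<close> the factor would be
  \<open>ell / (ell + mu_Phi A L)\<close>, whence the \<open>1 / 2\<close> here.\<close>

lemma proximal_point_contraction:
  fixes A :: "real^'n^'m"
  assumes "A \<noteq> 0" and sc: "sc_smooth \<mu> L \<phi> g" "0 \<le> \<mu>" "0 < L"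
    and xs: "A *v xs = b" "g xs + transpose A *v ls = 0" "ls \<in> range ((*v) A)"
    and l0: "l0 \<in> range ((*v) A)"
    and l: "l = l0 + (1 / mu_Phi A L) *\<^sub>R (A *v x - b)" "g x + transpose A *v l = 0"
  shows "norm (l - ls) \<le> norm (l0 - ls) / 2" "l \<in> range ((*v) A)"
proof -
  have sub: "subspace (range ((*v) A))"
    by (simp add: linear_subspace_image)
  have b: "b \<in> range ((*v) A)"
    using xs(1) by blast
  have \<sigma>: "0 < sigma_min A"
    by (rule sigma_min_pos) fact
  show l_range: "l \<in> range ((*v) A)"
    unfolding l(1) using l0 b sub by (intro subspace_add subspace_scale subspace_diff) auto
  let ?e = "l - ls" and ?d = "l0 - ls"
  have "g x = - (transpose A *v l)" "g xs = - (transpose A *v ls)"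
    using l(2) xs(2) by (simp_all add: eq_neg_iff_add_eq_0)
  then have "g x - g xs = - (transpose A *v ?e)"
    by (simp add: matrix_vector_mult_diff_distrib)
  then have "(norm (transpose A *v ?e))\<^sup>2 \<le> L * ((- (transpose A *v ?e)) \<bullet> (x - xs))"
    using sc_smooth_cocoercive[OF sc, of x xs] by simp
  also have "\<dots> = - L * (?e \<bullet> (A *v x - b))"
    by (simp add: inner_transpose_matrix_vector matrix_vector_mult_diff_distrib[of A] xs(1))
  \<comment> \<open>From here on \<open>L * mu_Phi A L = (sigma_min A)\<^sup>2\<close> puts the same
    constant on both sides.\<close>
  also have "A *v x - b = mu_Phi A L *\<^sub>R (?e - ?d)"
    using \<sigma> sc(3) by (simp add: l(1) mu_Phi_def)
  also have "- L * (?e \<bullet> (mu_Phi A L *\<^sub>R (?e - ?d))) = (sigma_min A)\<^sup>2 * (?e \<bullet> ?d - ?e \<bullet> ?e)"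
    using sc(3) by (simp add: mu_Phi_def inner_diff_right) (simp add: algebra_simps)
  finally have "(norm (transpose A *v ?e))\<^sup>2 \<le> (sigma_min A)\<^sup>2 * (?e \<bullet> ?d - ?e \<bullet> ?e)" .
  moreover have "(sigma_min A * norm ?e)\<^sup>2 \<le> (norm (transpose A *v ?e))\<^sup>2"
    using \<sigma> sub l_range xs(3) \<open>A \<noteq> 0\<close>
    by (intro power_mono sigma_min_le_norm_transpose subspace_diff) auto
  ultimately have "(sigma_min A)\<^sup>2 * (norm ?e)\<^sup>2 \<le> (sigma_min A)\<^sup>2 * (?e \<bullet> ?d - ?e \<bullet> ?e)"
    by (simp add: power_mult_distrib)
  then have "(norm ?e)\<^sup>2 \<le> ?e \<bullet> ?d - (norm ?e)\<^sup>2"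
    using \<sigma> by (simp add: power2_norm_eq_inner)
  then have "2 * norm ?e * norm ?e \<le> norm ?d * norm ?e"
    using norm_cauchy_schwarz[of ?e ?d] by (simp add: power2_eq_square mult.commute)
  then show "norm ?e \<le> norm ?d / 2"
    by (cases "?e = 0") auto
qed

text \<open>For this \<open>ell\<close> the parameter \<open>r\<close> is \<open>1 / 12\<close>
  whatever the problem, so the number of rounds per digit does not depend on the
  conditioning.\<close>

lemma ippa_radius_mu_Phi:
  fixes A :: "real^'n^'m"
  assumes "A \<noteq> 0" "0 < L"
  shows "ippa_radius A L (mu_Phi A L) R k = sqrt (11 / 12) ^ k * R"
proof -
  have "mu_Phi A L > 0"
    using sigma_min_pos[OF assms(1)] assms(2) by (simp add: mu_Phi_def)
  then have "1 - mu_Phi A L / (12 * mu_Phi A L) = 11 / 12"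
    by simp
  moreover have "(11 / 12) powr (real k / 2) = sqrt (11 / 12 :: real) ^ k"
    by (simp add: powr_half_sqrt[symmetric] powr_power)
  ultimately show ?thesis
    by (simp only: ippa_radius_def Let_def)
qed

text \<open>
  Each exact proximal step halves the distance of the multipliers to \<open>ls\<close>, so that both the
  dual error and the error of the inner solver decay like \<open>sqrt (11 / 12) ^ k\<close>.
\<close>

lemma ippa_converges:
  fixes A :: "real^'n^'m" and \<phi> :: "real^'n \<Rightarrow> real"
  assumes A: "A \<noteq> 0" "onorm ((*v) A) \<le> L_A"
    and sc: "sc_smooth \<mu> L \<phi> g" and \<mu>: "0 < \<mu>"
    and xs: "A *v xs = b" "g xs + transpose A *v ls = 0" "ls \<in> range ((*v) A)"
    and R: "0 < R"
    and E: "norm ls \<le> E" "5 / 2 * (L_A * R / mu_Phi A L) \<le> E"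
    and X: "norm (x0 - xs) \<le> X" "R + L_A * E / \<mu> \<le> X"
    and \<Lambda>: "0 \<le> \<Lambda>" "2 * ((L + L_A\<^sup>2 / mu_Phi A L) / \<mu>)\<^sup>2 * (3 * X / R)\<^sup>2 \<le> exp \<Lambda>"
  shows "\<exists>x l N. ippa A b L_A \<phi> L \<mu> (mu_Phi A L) R x0 T x l N
    \<and> l \<in> range ((*v) A)
    \<and> norm (l - ls) \<le> sqrt (11 / 12) ^ T * E
    \<and> norm (x - xs) \<le> sqrt (11 / 12) ^ T * X
    \<and> real N \<le> real T * (2 * (sqrt ((L + L_A\<^sup>2 / mu_Phi A L) / \<mu>) * \<Lambda> + 2))"
proof (induction T)
  case 0
  have "0 \<in> range ((*v) A)"
    by (metis matrix_vector_mult_0_right rangeI)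
  then show ?case
    using E X by (auto intro!: exI[of _ x0] exI[of _ "0 :: real^'m"] exI[of _ "0 :: nat"] ippa.init)
next
  case (Suc k)
  define ell where "ell = mu_Phi A L"
  define q :: real where "q = sqrt (11 / 12)"
  have q: "5 / 6 \<le> q" "0 < q"
    unfolding q_def by (rule real_le_rsqrt, simp add: power2_eq_square) simp
  have \<sigma>: "0 < sigma_min A" "sigma_min A \<le> L_A"
    using sigma_min_pos sigma_min_le_bound A by blast+
  have L: "0 < L" "\<mu> \<le> L"
    using sc_smooth_le[OF sc] \<mu> by auto
  have ell: "0 < ell"
    using \<sigma> L by (simp add: ell_def mu_Phi_def)
  define L' where "L' = L + L_A\<^sup>2 / ell"
  have L': "\<mu> \<le> L'"
    using L ell by (simp add: L'_def add_increasing2)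
  obtain x l N where IH: "ippa A b L_A \<phi> L \<mu> ell R x0 k x l N" "l \<in> range ((*v) A)"
    "norm (l - ls) \<le> q ^ k * E" "norm (x - xs) \<le> q ^ k * X"
    "real N \<le> real k * (2 * (sqrt (L' / \<mu>) * \<Lambda> + 2))"
    using Suc.IH unfolding q_def ell_def L'_def by blast
  define \<Psi> where "\<Psi> = ippa_objective A b \<phi> ell l"
  define g' where "g' x = g x + transpose A *v (l + (1 / ell) *\<^sub>R (A *v x - b))" for x
  have sc': "sc_smooth \<mu> L' \<Psi> g'"
    unfolding \<Psi>_def g'_def L'_def by (rule sc_smooth_ippa_objective[OF sc A(2) ell])
  \<comment> \<open>The exact minimiser is the reference point: the error of the round splits into
    that of the exact step and that of the inner solver.\<close>
  obtain xk where "optimal_solution \<Psi> UNIV xk"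
    using sc_smooth_attains_min[OF sc' \<mu>, of UNIV 0] by auto
  then have "\<Psi> xk \<le> \<Psi> y" for y
    by (simp add: is_arg_min_def not_less)
  then have "g' xk \<bullet> g' xk = 0"
    by (intro line_minimum_grad_orthogonal[OF sc_smoothD(1)[OF sc']])
  then have xk: "g' xk = 0"
    by simp
  define lk where "lk = l + (1 / ell) *\<^sub>R (A *v xk - b)"
  have gxk: "g xk + transpose A *v lk = 0"
    using xk by (simp add: g'_def lk_def)
  have "norm (lk - ls) \<le> norm (l - ls) / 2"
    using lk_def gxk unfolding ell_def
    by (intro proximal_point_contraction(1)[OF A(1) sc _ L(1) xs IH(2)]) (use \<mu> in auto)
  then have lk: "norm (lk - ls) \<le> q ^ k * E / 2"
    using IH(3) by simp
  have E_pos: "0 \<le> E"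
    using E(1) norm_ge_zero order_trans by blast
  \<comment> \<open>Because \<open>q \<ge> 5 / 6\<close>, halving uses at most \<open>3 / 5\<close>
    of the new allowance \<open>q ^ Suc k * E\<close>. The other \<open>2 / 5\<close> pays for the
    inner error, which is the origin of \<open>5 / 2\<close> in the assumption on
    \<open>E\<close>.\<close>
  have half: "q ^ k * E / 2 \<le> 3 / 5 * (q ^ Suc k * E)"
    using mult_right_mono[OF q(1), of "q ^ k * E"] q E_pos by simp
  have half': "q ^ k * E / 2 \<le> q ^ Suc k * E"
  proof -
    have "0 \<le> q ^ Suc k * E"
      using q E_pos by simp
    with half show ?thesis
      by linarith
  qed
  have xk_xs: "norm (xk - xs) \<le> q ^ Suc k * (L_A * E / \<mu>)"
  proof -
    have "g xk = - (transpose A *v lk)" "g xs = - (transpose A *v ls)"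
      using gxk xs(2) by (simp_all add: eq_neg_iff_add_eq_0)
    then have "g xk - g xs = - (transpose A *v (lk - ls))"
      by (simp add: matrix_vector_mult_diff_distrib)
    then have "\<mu> * norm (xk - xs) \<le> norm (transpose A *v (lk - ls))"
      using sc_smooth_norm_le_grad[OF sc, of xk xs] by simp
    also have "\<dots> \<le> L_A * norm (lk - ls)"
      by (rule norm_transpose_le[OF A(2)])
    also have "\<dots> \<le> L_A * (q ^ Suc k * E)"
      using lk half' \<sigma> by (intro mult_left_mono) linarith+
    finally show ?thesis
      using \<mu> by (simp add: field_simps)
  qed
  have X_pos: "0 \<le> X"
    using X(1) norm_ge_zero order_trans by blast
  have \<delta>: "ippa_radius A L ell R (Suc k) = q ^ Suc k * R"
    unfolding ell_def q_def by (rule ippa_radius_mu_Phi[OF A(1) L(1)])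
  have \<delta>_pos: "0 < q ^ Suc k * R"
    using q R by simp
  \<comment> \<open>The warm start keeps the ratio of distance to tolerance fixed: \<open>2\<close>
    of the \<open>3\<close> comes from the old iterate via \<open>1 \<le> 2 * q\<close>, the rest
    from \<open>xk\<close>.\<close>
  have start: "norm (x - xk) \<le> (3 * X / R) * (q ^ Suc k * R)"
  proof -
    have "L_A * E / \<mu> \<le> X"
      using X(2) R by linarith
    then have "norm (xk - xs) \<le> q ^ Suc k * X"
      using xk_xs q by (meson less_imp_le mult_left_mono order_trans zero_le_power)
    moreover have "q ^ k * X \<le> 2 * (q ^ Suc k * X)"
      using mult_right_mono[of 1 "2 * q" "q ^ k * X"] q X_pos by simp
    moreover have "norm (x - xk) \<le> norm (x - xs) + norm (xk - xs)"
      using norm_triangle_ineq4[of "x - xs" "xk - xs"] by simp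
    ultimately have "norm (x - xk) \<le> 3 * (q ^ Suc k * X)"
      using IH(4) by linarith
    then show ?thesis
      using R by (simp add: field_simps)
  qed
  obtain x' N' where agd: "agd \<Psi> L' \<mu> x (q ^ Suc k * R) x' N'"
    "norm (x' - xk) \<le> q ^ Suc k * R" "real N' \<le> sqrt (L' / \<mu>) * \<Lambda> + 2"
    using agd_terminates[OF sc' \<mu> L' xk \<delta>_pos start \<Lambda>(1)] \<Lambda>(2)
    unfolding L'_def ell_def by blast
  define l' where "l' = l + (1 / ell) *\<^sub>R (A *v x' - b)"
  have ippa: "ippa A b L_A \<phi> L \<mu> ell R x0 (Suc k) x' l' (N + 2 * N')"
    unfolding l'_def by (rule ippa.step[OF IH(1)]) (use agd(1) in \<open>simp only: \<delta> \<Psi>_def L'_def\<close>)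
  have l'_range: "l' \<in> range ((*v) A)"
  proof -
    have sub: "subspace (range ((*v) A))"
      by (simp add: linear_subspace_image)
    show ?thesis
      unfolding l'_def using sub IH(2) xs(1) by (intro subspace_add subspace_scale subspace_diff) auto
  qed
  have "norm (l' - ls) \<le> q ^ Suc k * E"
  proof -
    have "l' - ls = (lk - ls) + (1 / ell) *\<^sub>R (A *v (x' - xk))"
      by (simp add: l'_def lk_def matrix_vector_mult_diff_distrib algebra_simps)
    then have "norm (l' - ls) \<le> norm (lk - ls) + norm ((1 / ell) *\<^sub>R (A *v (x' - xk)))"
      by (metis norm_triangle_ineq)
    also have "norm ((1 / ell) *\<^sub>R (A *v (x' - xk))) \<le> 1 / ell * (L_A * (q ^ Suc k * R))"
    proof -
      have "norm (A *v (x' - xk)) \<le> L_A * norm (x' - xk)"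
        by (rule norm_matrix_vector_le[OF A(2)])
      also have "\<dots> \<le> L_A * (q ^ Suc k * R)"
        using agd(2) \<sigma> by (intro mult_left_mono) auto
      finally show ?thesis
        using ell by (simp add: divide_right_mono)
    qed
    also have "\<dots> = q ^ Suc k * (L_A * R / ell)"
      by simp
    also have "\<dots> \<le> q ^ Suc k * (2 / 5 * E)"
    proof (intro mult_left_mono)
      show "L_A * R / ell \<le> 2 / 5 * E"
        using E(2) unfolding ell_def by linarith
    qed (use q in simp)
    finally show ?thesis
      using lk half by linarith
  qed
  moreover have "norm (x' - xs) \<le> q ^ Suc k * X"
  proof -
    have "norm (x' - xs) \<le> norm (x' - xk) + norm (xk - xs)"
      using norm_triangle_ineq[of "x' - xk" "xk - xs"] by simp
    also have "\<dots> \<le> q ^ Suc k * (R + L_A * E / \<mu>)"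
      using agd(2) xk_xs unfolding distrib_left by linarith
    also have "\<dots> \<le> q ^ Suc k * X"
      using X(2) q by (intro mult_left_mono) auto
    finally show ?thesis .
  qed
  moreover have "real (N + 2 * N') \<le> real (Suc k) * (2 * (sqrt (L' / \<mu>) * \<Lambda> + 2))"
    using IH(5) agd(3) by (simp add: algebra_simps)
  ultimately show ?case
    using ippa l'_range unfolding q_def ell_def L'_def by blast
qed

section \<open>Polynomial bookkeeping in powers of one number, and the cost of one run\<close>

lemma le_power_mult:
  fixes M :: real
  assumes "1 \<le> M" "0 \<le> a" "0 \<le> b" "a \<le> M ^ i" "b \<le> M ^ j" "i + j \<le> k"
  shows "a * b \<le> M ^ k"
proof -
  have "a * b \<le> M ^ i * M ^ j"
    using assms by (intro mult_mono) auto
  also have "\<dots> \<le> M ^ k"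
    using assms by (simp add: power_add[symmetric] power_increasing)
  finally show ?thesis .
qed

lemma le_power_divide:
  fixes M :: real
  assumes "1 \<le> M" "0 \<le> a" "0 < b" "a \<le> M ^ i" "1 / b \<le> M ^ j" "i + j \<le> k"
  shows "a / b \<le> M ^ k"
  using le_power_mult[of M a "1 / b" i j k] assms by simp

lemma le_power_add:
  fixes M :: real
  assumes "2 \<le> M" "a \<le> M ^ i" "b \<le> M ^ j" "i < k" "j < k"
  shows "a + b \<le> M ^ k"
proof -
  have "a + b \<le> M ^ (k - 1) + M ^ (k - 1)"
    using assms by (intro add_mono) (auto intro: order_trans[OF _ power_increasing])
  also have "\<dots> \<le> M * M ^ (k - 1)"
    using assms by (simp add: mult_right_mono flip: mult_2)
  also have "\<dots> = M ^ k"
    using assms by (simp flip: power_Suc)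
  finally show ?thesis .
qed

text \<open>\<open>\<Lambda>\<close> stands for the logarithms of the data and
  \<open>\<Gamma>\<close> for that of the accuracy. They are kept apart because the length of an
  inner run depends on \<open>\<Lambda>\<close> alone; this is how
  \<open>ln (1 / \<epsilon>)\<close> enters (i) only linearly.\<close>

lemma ippa_complexity:
  fixes A :: "real^'n^'m" and \<phi> :: "real^'n \<Rightarrow> real"
  assumes A: "A \<noteq> 0" "onorm ((*v) A) \<le> L_A"
    and sc: "sc_smooth \<mu> L \<phi> g" and \<mu>: "0 < \<mu>"
    and xs: "A *v xs = b" "g xs + transpose A *v ls = 0" "ls \<in> range ((*v) A)"
    and R: "0 < R" and \<eta>: "0 < \<eta>"
    and \<Lambda>: "1 \<le> \<Lambda>" "0 \<le> \<Gamma>"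
    and bounds: "L_A \<le> exp \<Lambda>" "1 / sigma_min A \<le> exp \<Lambda>" "L \<le> exp \<Lambda>" "1 / \<mu> \<le> exp \<Lambda>"
      "R \<le> exp \<Lambda>" "1 / R \<le> exp \<Lambda>" "norm (x0 - xs) \<le> exp \<Lambda>" "norm ls \<le> exp \<Lambda>"
      "1 / \<eta> \<le> exp \<Gamma>"
  shows "\<exists>T x l N. ippa A b L_A \<phi> L \<mu> (mu_Phi A L) R x0 T x l N \<and> norm (x - xs) \<le> \<eta>
    \<and> real N \<le> 41000 * (L_A / sigma_min A) * sqrt (L / \<mu>) * \<Lambda> * (\<Lambda> + \<Gamma>)"
proof -
  \<comment> \<open>All data and their needed reciprocals lie below \<open>M\<close>, so every
    compound quantity is at most a power of \<open>M\<close>; taking logarithms turns the exponents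
    into numerals.\<close>
  define M where "M = exp \<Lambda>"
  define ell where "ell = mu_Phi A L"
  define \<sigma> where "\<sigma> = sigma_min A"
  define \<kappa> where "\<kappa> = L_A / \<sigma>"
  define L' where "L' = L + L_A\<^sup>2 / ell"
  have M: "2 \<le> M" "1 \<le> M"
    using exp_ge_add_one_self[of \<Lambda>] \<Lambda>(1) unfolding M_def by linarith+
  have bd: "L_A \<le> M ^ 1" "1 / \<sigma> \<le> M ^ 1" "L \<le> M ^ 1" "1 / \<mu> \<le> M ^ 1" "R \<le> M ^ 1"
    "1 / R \<le> M ^ 1" "norm (x0 - xs) \<le> M ^ 1" "norm ls \<le> M ^ 1"
    using bounds by (auto simp: M_def \<sigma>_def)
  have \<sigma>: "0 < \<sigma>" "\<sigma> \<le> L_A" "0 < L_A"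
    using sigma_min_pos[OF A(1)] sigma_min_le_bound[OF A] unfolding \<sigma>_def by linarith+
  have L: "0 < L" "\<mu> \<le> L"
    using sc_smooth_le[OF sc] \<mu> by auto
  have \<kappa>: "1 \<le> \<kappa>" "1 \<le> sqrt (L / \<mu>)"
    using \<sigma> L \<mu> by (auto simp: \<kappa>_def)
  have L'_eq: "L' = L * (1 + \<kappa>\<^sup>2)"
    using \<sigma> L by (simp add: L'_def ell_def mu_Phi_def \<kappa>_def \<sigma>_def[symmetric] field_simps)
  have \<kappa>_le: "\<kappa> \<le> M ^ 2"
    unfolding \<kappa>_def by (rule le_power_divide[OF M(2) _ \<sigma>(1) bd(1,2)]) (use \<sigma> in auto)
  have inv_ell: "L_A * R / mu_Phi A L \<le> M ^ 5"
  proof -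
    have "L_A * R / mu_Phi A L = L * (L_A * R * (1 / \<sigma> * (1 / \<sigma>)))"
      using \<sigma> L by (simp add: mu_Phi_def \<sigma>_def power2_eq_square)
    also have "\<dots> \<le> M ^ 5"
      by (rule le_power_mult[OF M(2) _ _ bd(3) le_power_mult[OF M(2) _ _
            le_power_mult[OF M(2) _ _ bd(1,5)] le_power_mult[OF M(2) _ _ bd(2,2)]]])
        (use \<sigma> L R in auto)
    finally show ?thesis .
  qed
  \<comment> \<open>The witnesses for \<open>ippa_converges\<close> are \<open>E = M ^ 7\<close>
    here and \<open>X = M ^ 10\<close> below.\<close>
  have E: "norm ls \<le> M ^ 7" "5 / 2 * (L_A * R / mu_Phi A L) \<le> M ^ 7"
  proof -
    show "norm ls \<le> M ^ 7"
      using bd(8) power_increasing[of 1 7 M] M by simp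
    have "5 / 2 \<le> M ^ 2"
      using M power_mono[of 2 M 2] by simp
    from le_power_mult[OF M(2) _ _ this inv_ell, of 7]
    show "5 / 2 * (L_A * R / mu_Phi A L) \<le> M ^ 7"
      using \<sigma> L R by (simp add: mu_Phi_def)
  qed
  have X: "norm (x0 - xs) \<le> M ^ 10" "R + L_A * M ^ 7 / \<mu> \<le> M ^ 10"
  proof -
    show "norm (x0 - xs) \<le> M ^ 10"
      using bd(7) power_increasing[of 1 10 M] M by simp
    show "R + L_A * M ^ 7 / \<mu> \<le> M ^ 10"
      by (rule le_power_add[OF M(1) bd(5) le_power_divide[OF M(2) _ \<mu>
              le_power_mult[OF M(2) _ _ bd(1) order_refl order_refl] bd(4) order_refl]])
        (use \<sigma> M in auto)
  qed
  \<comment> \<open>\<open>41 = 5 + 2 * 7 + 2 * 11\<close>, from the bounds on \<open>18\<close>,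
    \<open>L' / \<mu>\<close> and \<open>M ^ 10 / R\<close>.\<close>
  have \<Lambda>': "2 * (L' / \<mu>)\<^sup>2 * (3 * M ^ 10 / R)\<^sup>2 \<le> exp (41 * \<Lambda>)"
  proof -
    have "1 + \<kappa>\<^sup>2 \<le> M ^ 5"
      unfolding power2_eq_square
      by (rule le_power_add[OF M(1) _ le_power_mult[OF M(2) _ _ \<kappa>_le \<kappa>_le order_refl], of _ 0])
        (use \<kappa> in auto)
    from le_power_mult[OF M(2) _ _ bd(3) this, of 6] have "L * (1 + \<kappa>\<^sup>2) \<le> M ^ 6"
      using L by simp
    from le_power_divide[OF M(2) _ \<mu> this bd(4), of 7] have 1: "L' / \<mu> \<le> M ^ 7"
      unfolding L'_eq using L by simp
    have 2: "M ^ 10 / R \<le> M ^ 11"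
      by (rule le_power_divide[OF M(2) _ R order_refl bd(6)]) (use M in auto)
    have 3: "18 \<le> M ^ 5"
      using M power_mono[of 2 M 5] by simp
    have 4: "0 \<le> L' / \<mu>"
      unfolding L'_eq using L \<mu> by simp
    have "2 * (L' / \<mu>)\<^sup>2 * (3 * M ^ 10 / R)\<^sup>2 =
        18 * ((L' / \<mu> * (L' / \<mu>)) * (M ^ 10 / R * (M ^ 10 / R)))"
      by (simp add: power2_eq_square)
    also have "\<dots> \<le> M ^ 41"
      by (rule le_power_mult[OF M(2) _ _ 3 le_power_mult[OF M(2) _ _
            le_power_mult[OF M(2) 4 4 1 1 order_refl] le_power_mult[OF M(2) _ _ 2 2 order_refl] order_refl]])
        (use 4 M R in auto)
    also have "\<dots> = exp (41 * \<Lambda>)"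
      by (simp add: M_def exp_of_nat_mult[symmetric])
    finally show ?thesis .
  qed
  \<comment> \<open>The initial bound \<open>M ^ 10\<close> has to fall below
    \<open>exp (- \<Gamma>)\<close>, and each round gains a factor \<open>exp (- (1 / 24))\<close>
    because \<open>11 / 12 = 1 - 1 / 12 \<le> exp (- (1 / 12))\<close>.\<close>
  define T where "T = nat \<lceil>24 * (10 * \<Lambda> + \<Gamma>)\<rceil>"
  have T: "24 * (10 * \<Lambda> + \<Gamma>) \<le> real T" "real T \<le> 241 * (\<Lambda> + \<Gamma>)"
    unfolding T_def using \<Lambda> of_int_ceiling_le_add_one[of "24 * (10 * \<Lambda> + \<Gamma>)"]
    by (auto simp: of_nat_nat) linarith+
  obtain x l N where ippa: "ippa A b L_A \<phi> L \<mu> ell R x0 T x l N"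
    and x: "norm (x - xs) \<le> sqrt (11 / 12) ^ T * M ^ 10"
    and N: "real N \<le> real T * (2 * (sqrt (L' / \<mu>) * (41 * \<Lambda>) + 2))"
    using ippa_converges[OF A sc \<mu> xs R E X, of "41 * \<Lambda>" T] \<Lambda>' \<Lambda>(1)
    unfolding L'_def ell_def by auto
  have "sqrt (11 / 12) ^ T * M ^ 10 \<le> \<eta>"
  proof -
    have "sqrt (11 / 12) \<le> exp (- (1 / 24) :: real)"
    proof (rule real_le_lsqrt)
      show "11 / 12 \<le> (exp (- (1 / 24) :: real))\<^sup>2"
        using exp_ge_add_one_self[of "- (1 / 12)"] by (simp add: exp_double[symmetric])
    qed auto
    then have "sqrt (11 / 12) ^ T * M ^ 10 \<le> exp (- (1 / 24)) ^ T * M ^ 10"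
      using M by (intro mult_right_mono power_mono) auto
    also have "\<dots> = exp (10 * \<Lambda> - T / 24)"
      by (simp add: M_def exp_of_nat_mult[symmetric] exp_add[symmetric])
    also have "\<dots> \<le> exp (- \<Gamma>)"
      using T(1) by simp
    also have "\<dots> \<le> \<eta>"
      using bounds(9) \<eta> by (simp add: exp_minus field_simps)
    finally show ?thesis .
  qed
  moreover have "real N \<le> 41000 * \<kappa> * sqrt (L / \<mu>) * \<Lambda> * (\<Lambda> + \<Gamma>)"
  proof -
    define s where "s = sqrt (L / \<mu>)"
    have "L' / \<mu> \<le> (2 * \<kappa> * s)\<^sup>2"
    proof -
      have "(L / \<mu>) * (1 + \<kappa>\<^sup>2) \<le> (L / \<mu>) * (4 * \<kappa>\<^sup>2)"
      proof (intro mult_left_mono)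
        show "1 + \<kappa>\<^sup>2 \<le> 4 * \<kappa>\<^sup>2"
          using one_le_power[OF \<kappa>(1), of 2] by linarith
      qed (use L \<mu> in simp)
      then show ?thesis
        using L \<mu> by (simp add: L'_eq s_def power_mult_distrib mult_ac)
    qed
    then have "sqrt (L' / \<mu>) \<le> 2 * \<kappa> * s"
      using \<kappa> by (intro real_le_lsqrt) (auto simp: s_def)
    define p where "p = \<kappa> * s * \<Lambda>"
    define u where "u = sqrt (L' / \<mu>) * (41 * \<Lambda>)"
    have "u \<le> (2 * \<kappa> * s) * (41 * \<Lambda>)"
      unfolding u_def using \<open>sqrt (L' / \<mu>) \<le> 2 * \<kappa> * s\<close> \<Lambda> by (intro mult_right_mono) auto
    then have u: "0 \<le> u" "u \<le> 82 * p"
      using L \<mu> \<Lambda> by (simp_all add: u_def p_def L'_eq)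
    have p: "1 \<le> p"
      using mult_mono[OF mult_mono[OF \<kappa>] \<Lambda>(1)] \<kappa> by (simp add: p_def s_def)
    have "real N \<le> real T * (2 * (u + 2))"
      using N by (simp only: u_def)
    \<comment> \<open>\<open>168 = 2 * (82 + 2)\<close>, using \<open>1 \<le> p\<close> to absorb
      the additive \<open>2\<close>.\<close>
    also have "\<dots> \<le> (241 * (\<Lambda> + \<Gamma>)) * (168 * p)"
      using \<Lambda> u p by (intro mult_mono[OF T(2)]) simp_all
    also have "\<dots> = 40488 * (p * (\<Lambda> + \<Gamma>))"
      by simp
    also have "\<dots> \<le> 41000 * (p * (\<Lambda> + \<Gamma>))"
      using p \<Lambda> by (intro mult_right_mono mult_nonneg_nonneg) simp_all
    finally show ?thesis
      by (simp add: s_def p_def mult.assoc)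
  qed
  ultimately show ?thesis
    using ippa x unfolding \<kappa>_def \<sigma>_def ell_def
    by (intro exI[of _ T] exI[of _ x] exI[of _ l] exI[of _ N]) simp
qed

section \<open>Logarithmic factors\<close>

lemma log_factor_ge_one: "1 \<le> log_factor ps"
proof -
  have "0 \<le> (\<Sum>p\<leftarrow>ps. \<bar>ln p\<bar>)"
    by (rule sum_list_nonneg) auto
  then show ?thesis
    by (simp add: log_factor_def)
qed

lemma log_factor_bounds:
  assumes "p \<in> set ps" "0 < p"
  shows "p \<le> exp (log_factor ps)" "1 / p \<le> exp (log_factor ps)"
proof -
  have le_sum: "\<bar>ln p\<bar> \<le> (\<Sum>p\<leftarrow>ps. \<bar>ln p\<bar>)"
    using assms(1) by (intro member_le_sum_list) auto
  have "\<bar>ln p\<bar> \<le> log_factor ps"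
    unfolding log_factor_def using le_sum by linarith
  then have "exp (ln p) \<le> exp (log_factor ps)" "exp (- ln p) \<le> exp (log_factor ps)"
    unfolding exp_le_cancel_iff by linarith+
  then show "p \<le> exp (log_factor ps)" "1 / p \<le> exp (log_factor ps)"
    using assms(2) by (simp_all add: exp_minus divide_inverse)
qed

section \<open>The complexity bounds\<close>

text \<open>In all three cases one logarithm counts the rounds and another the iterations of an
  inner run, hence this quadratic form.\<close>

lemma soft_O_I:
  assumes "real N \<le> c * M * log_factor ps ^ 2" "c \<le> 10 ^ 10" "0 \<le> M"
  shows "soft_O N M ps"
proof -
  have lf: "1 \<le> log_factor ps"
    by (rule log_factor_ge_one)
  have "c * M * log_factor ps ^ 2 \<le> 10 ^ 10 * M * log_factor ps ^ 3"
    using assms lf by (intro mult_mono power_increasing) auto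
  with assms(1) show ?thesis
    by (simp add: soft_O_def)
qed

lemma feasible_props:
  shows closed_feasible: "closed (feasible A b)"
    and convex_feasible: "convex (feasible A b)"
proof -
  have "continuous_on UNIV ((*v) A)"
    by (intro linear_continuous_on) (simp add: linear_linear)
  then show "closed (feasible A b)"
    unfolding feasible_def by (intro closed_Collect_eq) auto
  show "convex (feasible A b)"
    by (auto simp: feasible_def convex_def matrix_vector_right_distrib matrix_vector_mult_scaleR
        scaleR_add_left[symmetric])
qed

lemma ippa_soft_O_strongly_convex:
  fixes A :: "real^'n^'m"
  assumes A: "A \<noteq> 0" "onorm ((*v) A) \<le> L_A" and "0 < L_f" "0 < \<mu>\<^sub>f"
    and f: "smooth_fun L_f f" "strongly_convex \<mu>\<^sub>f f"
    and xs: "optimal_solution f (feasible A b) x\<^sub>s" and "0 < R" "0 < \<epsilon>"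
  shows "\<exists>T x l N. ippa A b L_A f L_f \<mu>\<^sub>f (mu_Phi A L_f) R x0 T x l N \<and>
    (norm (x - x\<^sub>s))\<^sup>2 \<le> \<epsilon> \<and>
    soft_O N (L_A / sigma_min A * sqrt (L_f / \<mu>\<^sub>f) * max 1 (ln (1 / \<epsilon>)))
      [L_A, sigma_min A, L_f, \<mu>\<^sub>f, R, 1 + norm (x0 - x\<^sub>s), 1 + infdist 0 (dual_solutions A b f)]"
proof -
  define ps where "ps = [L_A, sigma_min A, L_f, \<mu>\<^sub>f, R, 1 + norm (x0 - x\<^sub>s),
    1 + infdist 0 (dual_solutions A b f)]"
  define \<Lambda> where "\<Lambda> = log_factor ps"
  define \<Gamma> where "\<Gamma> = max 1 (ln (1 / \<epsilon>))"
  define \<kappa> where "\<kappa> = L_A / sigma_min A * sqrt (L_f / \<mu>\<^sub>f)"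
  have sc: "sc_smooth \<mu>\<^sub>f L_f f (grad f)"
    using f by (rule sc_smoothI_strongly_convex)
  obtain ls where ls: "ls \<in> range ((*v) A)" "grad f x\<^sub>s + transpose A *v ls = 0"
    using multiplier_exists[OF xs sc_smoothD(1)[OF sc]] .
  have ls_le: "norm ls \<le> infdist 0 (dual_solutions A b f)"
    using multiplier_norm_le_infdist[OF sc _ xs ls] \<open>0 < \<mu>\<^sub>f\<close> by simp
  have \<sigma>: "0 < sigma_min A" "sigma_min A \<le> L_A"
    using sigma_min_pos sigma_min_le_bound A by blast+
  have bd: "p \<le> exp \<Lambda>" "1 / p \<le> exp \<Lambda>" if "p \<in> set ps" "0 < p" for p
    unfolding \<Lambda>_def using log_factor_bounds[OF that] by auto
  have "1 + norm (x0 - x\<^sub>s) \<le> exp \<Lambda>" "1 + infdist 0 (dual_solutions A b f) \<le> exp \<Lambda>"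
    by (rule bd; simp add: ps_def add_pos_nonneg infdist_nonneg)+
  then have bd': "norm (x0 - x\<^sub>s) \<le> exp \<Lambda>" "norm ls \<le> exp \<Lambda>"
    using ls_le by linarith+
  \<comment> \<open>The target is a squared distance, so the accuracy requested is
    \<open>sqrt \<epsilon>\<close>. For \<open>\<epsilon> > 1\<close> the logarithm is negative and
    \<open>max 1\<close> takes over.\<close>
  have \<epsilon>: "1 / sqrt \<epsilon> \<le> exp \<Gamma>"
  proof (cases "\<epsilon> \<le> 1")
    case True
    have "\<epsilon> \<le> sqrt \<epsilon>"
      using True \<open>0 < \<epsilon>\<close> by (intro real_le_rsqrt) (simp add: power2_eq_square mult_left_le_one_le)
    then have "1 / sqrt \<epsilon> \<le> 1 / \<epsilon>"
      using \<open>0 < \<epsilon>\<close> by (intro divide_left_mono) auto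
    also have "\<dots> = exp (ln (1 / \<epsilon>))"
      using \<open>0 < \<epsilon>\<close> by simp
    also have "\<dots> \<le> exp \<Gamma>"
      by (simp add: \<Gamma>_def)
    finally show ?thesis .
  next
    case False
    then have "1 / sqrt \<epsilon> \<le> 1"
      by simp
    also have "1 \<le> exp \<Gamma>"
      by (simp add: \<Gamma>_def)
    finally show ?thesis .
  qed
  have \<Lambda>: "1 \<le> \<Lambda>"
    unfolding \<Lambda>_def by (rule log_factor_ge_one)
  have \<Gamma>: "1 \<le> \<Gamma>"
    by (simp add: \<Gamma>_def)
  have "A *v x\<^sub>s = b"
    using xs by (simp add: is_arg_min_def feasible_def)
  then obtain T x l N where ippa: "ippa A b L_A f L_f \<mu>\<^sub>f (mu_Phi A L_f) R x0 T x l N"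
    and x: "norm (x - x\<^sub>s) \<le> sqrt \<epsilon>"
    and N: "real N \<le> 41000 * (L_A / sigma_min A) * sqrt (L_f / \<mu>\<^sub>f) * \<Lambda> * (\<Lambda> + \<Gamma>)"
    using ippa_complexity[OF A sc \<open>0 < \<mu>\<^sub>f\<close> _ ls(2,1) \<open>0 < R\<close> _ \<Lambda> _ _ _ _ _ _ _ bd' \<epsilon>]
      bd[of L_A] bd[of "sigma_min A"] bd[of L_f] bd[of "\<mu>\<^sub>f"] bd[of R] \<sigma> assms \<Gamma>
    by (auto simp: ps_def)
  have "(norm (x - x\<^sub>s))\<^sup>2 \<le> \<epsilon>"
    using power_mono[OF x, of 2] \<open>0 < \<epsilon>\<close> by simp
  moreover have "soft_O N (\<kappa> * \<Gamma>) ps"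
  proof (rule soft_O_I[where c = 82000])
    have \<kappa>: "0 \<le> \<kappa>"
      using \<sigma> assms by (simp add: \<kappa>_def)
    then show "0 \<le> \<kappa> * \<Gamma>"
      using \<Gamma> by simp
    \<comment> \<open>Both summands are at least \<open>1\<close>, so the sum can be traded for a
      product; this separates \<open>\<Gamma>\<close>, which belongs to the main term, from the
      logarithmic factor.\<close>
    have "\<Lambda> + \<Gamma> \<le> 2 * (\<Lambda> * \<Gamma>)"
    proof -
      have "\<Lambda> * 1 \<le> \<Lambda> * \<Gamma>" "1 * \<Gamma> \<le> \<Lambda> * \<Gamma>"
        using \<Lambda> \<Gamma> by (intro mult_mono; simp)+
      then show ?thesis
        by simp
    qed
    then have "41000 * \<kappa> * \<Lambda> * (\<Lambda> + \<Gamma>) \<le> 41000 * \<kappa> * \<Lambda> * (2 * (\<Lambda> * \<Gamma>))"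
      using \<kappa> \<Lambda> by (intro mult_left_mono) auto
    also have "\<dots> = 82000 * (\<kappa> * \<Gamma>) * \<Lambda> ^ 2"
      by (simp add: power2_eq_square)
    finally show "real N \<le> 82000 * (\<kappa> * \<Gamma>) * log_factor ps ^ 2"
      using N by (simp add: \<kappa>_def \<Lambda>_def mult.assoc)
  qed simp
  ultimately show ?thesis
    using ippa unfolding \<kappa>_def \<Gamma>_def ps_def by blast
qed

text \<open>Half of \<open>\<epsilon>\<close> pays for the regulariser at \<open>x\<^sub>s\<close>,
  the other half for the inexact solution, both in value and in feasibility. The penalty weight
  \<open>\<rho>\<close> influences only the accuracy requested, hence only a logarithm.\<close>

lemma ippa_soft_O_convex:
  fixes A :: "real^'n^'m"
  assumes A: "A \<noteq> 0" "onorm ((*v) A) \<le> L_A" and pos: "0 < L_f" "0 < D" "0 < \<epsilon>"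
    and f: "smooth_fun L_f f" "convex_on UNIV f"
    and xs: "optimal_solution f (feasible A b) x\<^sub>s" "norm (x0 - x\<^sub>s) \<le> D" and "0 < R" "0 < \<rho>"
  shows "\<exists>T x l N. ippa A b L_A (\<lambda>x. f x + \<epsilon> / (2 * D\<^sup>2) * (norm (x - x0))\<^sup>2)
      (L_f + \<epsilon> / D\<^sup>2) (\<epsilon> / D\<^sup>2) (mu_Phi A (L_f + \<epsilon> / D\<^sup>2)) R x0 T x l N \<and>
    f x + \<rho> * norm (A *v x - b) - f x\<^sub>s \<le> \<epsilon> \<and>
    soft_O N (L_A / sigma_min A * max 1 (sqrt L_f * D / sqrt \<epsilon>))
      [L_A, sigma_min A, L_f, D, \<epsilon>, R, 1 + \<rho>, 1 + infdist 0 (dual_solutions A b f)]"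
proof -
  define ps where "ps = [L_A, sigma_min A, L_f, D, \<epsilon>, R, 1 + \<rho>,
    1 + infdist 0 (dual_solutions A b f)]"
  define lf where "lf = log_factor ps"
  define M where "M = exp lf"
  define \<sigma> where "\<sigma> = sigma_min A"
  define \<mu> where "\<mu> = \<epsilon> / D\<^sup>2"
  define L where "L = L_f + \<mu>"
  define \<phi> where "\<phi> x = f x + \<mu> / 2 * (norm (x - x0))\<^sup>2" for x
  define g where "g x = grad f x + \<mu> *\<^sub>R (x - x0)" for x
  have lf: "1 \<le> lf"
    unfolding lf_def by (rule log_factor_ge_one)
  have M: "2 \<le> M" "1 \<le> M" "0 < M"
    using exp_ge_add_one_self[of lf] lf unfolding M_def by linarith+
  have M_pow: "M ^ k = exp (real k * lf)" for k
    unfolding M_def by (rule exp_of_nat_mult[symmetric])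
  have \<mu>: "0 < \<mu>"
    using pos by (simp add: \<mu>_def)
  have L: "0 < L"
    using pos \<mu> by (simp add: L_def)
  have \<sigma>: "0 < \<sigma>" "\<sigma> \<le> L_A" "0 < L_A"
    using sigma_min_pos[OF A(1)] sigma_min_le_bound[OF A] unfolding \<sigma>_def by auto
  have bd: "p \<le> M ^ 1 \<and> 1 / p \<le> M ^ 1" if "p \<in> set ps" "0 < p" for p
    unfolding M_def lf_def using log_factor_bounds[OF that] by auto
  have bds: "L_A \<le> M ^ 1" "1 / \<sigma> \<le> M ^ 1" "L_f \<le> M ^ 1" "D \<le> M ^ 1" "1 / D \<le> M ^ 1"
    "\<epsilon> \<le> M ^ 1" "1 / \<epsilon> \<le> M ^ 1" "R \<le> M ^ 1" "1 / R \<le> M ^ 1"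
    using bd[of L_A] bd[of "sigma_min A"] bd[of L_f] bd[of D] bd[of \<epsilon>] bd[of R] \<sigma> pos \<open>0 < R\<close>
    by (auto simp: ps_def \<sigma>_def)
  have "1 + \<rho> \<le> M ^ 1" "1 + infdist 0 (dual_solutions A b f) \<le> M ^ 1"
    using bd[of "1 + \<rho>"] bd[of "1 + infdist 0 (dual_solutions A b f)"] \<open>0 < \<rho>\<close>
    by (auto simp: ps_def add_pos_nonneg infdist_nonneg)
  then have \<rho>: "\<rho> \<le> M ^ 1" and infdist_le: "infdist 0 (dual_solutions A b f) \<le> M ^ 1"
    by linarith+
  have sc_f: "sc_smooth 0 L_f f (grad f)"
    using f by (rule sc_smoothI_convex)
  have sc: "sc_smooth \<mu> L \<phi> g"
    using sc_smooth_add_square[OF sc_f, of "\<mu> / 2" x0] \<mu> by (simp add: L_def \<phi>_def[abs_def] g_def[abs_def])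
  have Axs: "A *v x\<^sub>s = b" "x\<^sub>s \<in> feasible A b"
    using xs(1) by (simp_all add: is_arg_min_def feasible_def)
  obtain xp where xp: "optimal_solution \<phi> (feasible A b) xp"
    using sc_smooth_attains_min[OF sc \<mu> closed_feasible Axs(2)] by blast
  have Axp: "A *v xp = b" "xp \<in> feasible A b"
    using xp by (simp_all add: is_arg_min_def feasible_def)
  have \<phi>_le: "\<phi> xp \<le> \<phi> x\<^sub>s" and f_le: "f x\<^sub>s \<le> f xp"
    using xp xs(1) Axs Axp unfolding is_arg_min_def by (meson not_less)+
  \<comment> \<open>Since \<open>f\<close> is no larger at \<open>x\<^sub>s\<close> than at
    \<open>xp\<close>, the regulariser cannot be larger at \<open>xp\<close> than at
    \<open>x\<^sub>s\<close>.\<close>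
  have xp_x0: "norm (xp - x0) \<le> D"
  proof -
    have "\<mu> / 2 * (norm (xp - x0))\<^sup>2 \<le> \<mu> / 2 * (norm (x\<^sub>s - x0))\<^sup>2"
      using \<phi>_le f_le by (simp add: \<phi>_def)
    then have "(norm (xp - x0))\<^sup>2 \<le> (norm (x\<^sub>s - x0))\<^sup>2"
      using \<mu> by simp
    then show ?thesis
      using xs(2) by (simp add: norm_minus_commute)
  qed
  obtain l where l: "l \<in> range ((*v) A)" "g xp + transpose A *v l = 0"
    using multiplier_exists[OF xp sc_smoothD(1)[OF sc]] .
  obtain lp where lp: "lp \<in> range ((*v) A)" "grad f x\<^sub>s + transpose A *v lp = 0"
    using multiplier_exists[OF xs(1) sc_smoothD(1)[OF sc_f]] .
  have lp_le: "norm lp \<le> M ^ 1"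
    using multiplier_norm_le_infdist[OF sc_f _ xs(1) lp] infdist_le by simp
  \<comment> \<open>The multiplier of the regularised problem is compared with that of the original
    one, whose norm the logarithmic factor already covers.\<close>
  have l_lp: "norm (l - lp) \<le> (2 * L_f * D + \<mu> * D) / \<sigma>"
  proof -
    have sub: "subspace (range ((*v) A))"
      by (simp add: linear_subspace_image)
    have "g xp = - (transpose A *v l)" "grad f x\<^sub>s = - (transpose A *v lp)"
      using l(2) lp(2) by (simp_all add: eq_neg_iff_add_eq_0)
    then have "transpose A *v (l - lp) = - ((grad f xp - grad f x\<^sub>s) + \<mu> *\<^sub>R (xp - x0))"
      by (simp add: matrix_vector_mult_diff_distrib g_def algebra_simps)
    then have "norm (transpose A *v (l - lp)) = norm ((grad f xp - grad f x\<^sub>s) + \<mu> *\<^sub>R (xp - x0))"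
      by (metis norm_minus_cancel)
    also have "\<dots> \<le> norm (grad f xp - grad f x\<^sub>s) + norm (\<mu> *\<^sub>R (xp - x0))"
      by (rule norm_triangle_ineq)
    also have "\<dots> \<le> L_f * (2 * D) + \<mu> * D"
    proof (rule add_mono)
      have "norm (xp - x\<^sub>s) \<le> norm (xp - x0) + norm (x0 - x\<^sub>s)"
        using norm_triangle_ineq[of "xp - x0" "x0 - x\<^sub>s"] by simp
      then have "L_f * norm (xp - x\<^sub>s) \<le> L_f * (2 * D)"
        using xp_x0 xs(2) pos by (intro mult_left_mono) linarith+
      then show "norm (grad f xp - grad f x\<^sub>s) \<le> L_f * (2 * D)"
        using sc_smoothD(3)[OF sc_f] order_trans by blast
      show "norm (\<mu> *\<^sub>R (xp - x0)) \<le> \<mu> * D"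
        using xp_x0 \<mu> by simp
    qed
    finally have "\<sigma> * norm (l - lp) \<le> 2 * L_f * D + \<mu> * D"
      using sigma_min_le_norm_transpose[OF A(1) subspace_diff[OF sub l(1) lp(1)]]
      by (simp add: \<sigma>_def)
    then show ?thesis
      using \<sigma> by (simp add: field_simps)
  qed
  have \<mu>_eq: "\<mu> = \<epsilon> / D / D" "1 / \<mu> = D * D / \<epsilon>"
    using pos by (simp_all add: \<mu>_def power2_eq_square)
  have \<mu>_le: "\<mu> \<le> M ^ 3"
    unfolding \<mu>_eq(1) by (rule le_power_divide[OF M(2) _ pos(2)
          le_power_divide[OF M(2) _ pos(2) bds(6) bds(5) order_refl] bds(5)]) (use pos in auto)
  have inv_\<mu>_le: "1 / \<mu> \<le> M ^ 6"
    unfolding \<mu>_eq(2) by (rule le_power_divide[OF M(2) _ pos(3)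
          le_power_mult[OF M(2) _ _ bds(4) bds(4) order_refl] bds(7)]) (use pos in auto)
  have L_le: "L \<le> M ^ 4"
    unfolding L_def by (rule le_power_add[OF M(1) bds(3) \<mu>_le]) auto
  have l_le: "norm l \<le> M ^ 6"
  proof -
    have two: "2 \<le> M ^ 1"
      using M by simp
    have "2 * L_f * D \<le> M ^ 3"
      by (rule le_power_mult[OF M(2) _ _ le_power_mult[OF M(2) _ _ two bds(3) order_refl] bds(4)])
        (use pos in auto)
    moreover have "\<mu> * D \<le> M ^ 3"
    proof -
      have "\<mu> * D = \<epsilon> / D"
        using pos by (simp add: \<mu>_eq)
      then show ?thesis
        using le_power_divide[OF M(2) _ pos(2) bds(6,5), of 3] pos by simp
    qed
    ultimately have 1: "2 * L_f * D + \<mu> * D \<le> M ^ 4"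
      by (rule le_power_add[OF M(1)]) auto
    have 2: "(2 * L_f * D + \<mu> * D) / \<sigma> \<le> M ^ 5"
      by (rule le_power_divide[OF M(2) _ \<sigma>(1) 1 bds(2)]) (use pos \<mu> in auto)
    have "norm l \<le> norm lp + norm (l - lp)"
      by (metis add.commute diff_add_cancel norm_triangle_ineq)
    also have "\<dots> \<le> norm lp + (2 * L_f * D + \<mu> * D) / \<sigma>"
      using l_lp by simp
    also have "\<dots> \<le> M ^ 6"
      by (rule le_power_add[OF M(1) lp_le 2]) auto
    finally show ?thesis .
  qed
  have pow6: "y \<le> exp (6 * lf)" if "y \<le> M ^ 1" for y
    using that power_increasing[of 1 6 M] M M_pow[of 6] by simp
  have dist_le: "norm (x0 - xp) \<le> M ^ 1"
    using xp_x0 bds(4) by (simp add: norm_minus_commute)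
  \<comment> \<open>The constants multiplying \<open>\<eta>\<close> in step \<open>4\<close> sum to
    at most \<open>M ^ 9\<close>; two more powers push the error below
    \<open>\<epsilon> / 2\<close>.\<close>
  define \<eta> where "\<eta> = 1 / M ^ 11"
  have \<eta>: "0 < \<eta>" "\<eta> \<le> 1"
    using M by (simp_all add: \<eta>_def)
  \<comment> \<open>\<open>\<Lambda> = 6 * lf\<close> because \<open>1 / \<mu>\<close> and
    \<open>norm l\<close> need \<open>M ^ 6\<close>, and \<open>\<Gamma> = 11 * lf\<close> matches
    \<open>\<eta>\<close>.\<close>
  have "\<exists>T x l N. ippa A b L_A \<phi> L \<mu> (mu_Phi A L) R x0 T x l N \<and> norm (x - xp) \<le> \<eta>
    \<and> real N \<le> 41000 * (L_A / sigma_min A) * sqrt (L / \<mu>) * (6 * lf) * (6 * lf + 11 * lf)"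
  proof (rule ippa_complexity[OF A sc \<mu> Axp(1) l(2,1) \<open>0 < R\<close> \<eta>(1)])
    show "L \<le> exp (6 * lf)"
      using L_le power_increasing[of 4 6 M] M M_pow[of 6] by simp
    show "1 / \<mu> \<le> exp (6 * lf)" "norm l \<le> exp (6 * lf)" "1 / \<eta> \<le> exp (11 * lf)"
      using inv_\<mu>_le l_le M_pow[of 6] M_pow[of 11] by (simp_all add: \<eta>_def)
  qed (use lf pow6 bds dist_le in \<open>auto simp: \<sigma>_def\<close>)
  then obtain T x l' N where ippa: "ippa A b L_A \<phi> L \<mu> (mu_Phi A L) R x0 T x l' N"
    and x: "norm (x - xp) \<le> \<eta>"
    and N: "real N \<le> 41000 * (L_A / sigma_min A) * sqrt (L / \<mu>) * (6 * lf) * (6 * lf + 11 * lf)"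
    by blast
  have "f x + \<rho> * norm (A *v x - b) - f x\<^sub>s \<le> \<epsilon>"
  proof -
    \<comment> \<open>The output may be infeasible, so the first-order term at the constrained
      minimiser need not vanish; the multiplier bounds it.\<close>
    have 1: "g xp \<bullet> (x - xp) \<le> L_A * norm l * \<eta>"
    proof -
      have "g xp = - (transpose A *v l)"
        using l(2) by (simp add: eq_neg_iff_add_eq_0)
      then have "norm (g xp) \<le> L_A * norm l"
        using norm_transpose_le[OF A(2), of l] by simp
      then have "norm (g xp) * norm (x - xp) \<le> L_A * norm l * \<eta>"
        using x \<sigma> by (intro mult_mono) auto
      then show ?thesis
        using norm_cauchy_schwarz[of "g xp" "x - xp"] by linarith
    qed
    have 2: "L / 2 * (norm (x - xp))\<^sup>2 \<le> L * \<eta>"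
    proof -
      have "(norm (x - xp))\<^sup>2 \<le> \<eta> * 1"
        unfolding power2_eq_square using x \<eta> by (intro mult_mono) auto
      then have "L / 2 * (norm (x - xp))\<^sup>2 \<le> L / 2 * \<eta>"
        using L by (intro mult_left_mono) auto
      then show ?thesis
        using mult_pos_pos[OF L \<eta>(1)] by simp
    qed
    have 3: "\<rho> * norm (A *v x - b) \<le> \<rho> * L_A * \<eta>"
    proof -
      have "norm (A *v x - b) \<le> L_A * norm (x - xp)"
        using norm_matrix_vector_le[OF A(2), of "x - xp"] by (simp add: matrix_vector_mult_diff_distrib Axp)
      also have "\<dots> \<le> L_A * \<eta>"
        using x \<sigma> by simp
      finally show ?thesis
        using \<open>0 < \<rho>\<close> by (simp add: mult.assoc)
    qed
    have 4: "(L_A * norm l + L + \<rho> * L_A) * \<eta> \<le> \<epsilon> / 2"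
    proof -
      have "L_A * norm l + L \<le> M ^ 8"
        by (rule le_power_add[OF M(1) le_power_mult[OF M(2) _ _ bds(1) l_le order_refl] L_le])
          (use \<sigma> in auto)
      then have "L_A * norm l + L + \<rho> * L_A \<le> M ^ 9"
        by (rule le_power_add[OF M(1) _ le_power_mult[OF M(2) _ _ \<rho> bds(1) order_refl]])
          (use \<sigma> \<open>0 < \<rho>\<close> in auto)
      then have "(L_A * norm l + L + \<rho> * L_A) * \<eta> \<le> M ^ 9 * \<eta>"
        using \<eta> by (intro mult_right_mono) auto
      also have "\<dots> = 1 / M * (1 / M)"
        using M by (simp add: \<eta>_def field_simps flip: power_Suc power_add)
      also have "\<dots> \<le> \<epsilon> * (1 / 2)"
        using M bds(7) pos by (intro mult_mono) (auto simp: field_simps)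
      finally show ?thesis
        by simp
    qed
    have 5: "\<phi> x\<^sub>s \<le> f x\<^sub>s + \<epsilon> / 2"
    proof -
      have "\<mu> / 2 * (norm (x\<^sub>s - x0))\<^sup>2 \<le> \<mu> / 2 * D\<^sup>2"
        using xs(2) \<mu> by (intro mult_left_mono power_mono) (auto simp: norm_minus_commute)
      also have "\<dots> = \<epsilon> / 2"
        using pos by (simp add: \<mu>_def)
      finally show ?thesis
        by (simp add: \<phi>_def)
    qed
    have 6: "f x \<le> \<phi> x"
      using \<mu> by (simp add: \<phi>_def)
    have "\<phi> x \<le> \<phi> xp + g xp \<bullet> (x - xp) + L / 2 * (norm (x - xp))\<^sup>2"
      by (rule sc_smoothD(5)[OF sc])
    then show ?thesis
      using 1 2 3 4 5 6 \<phi>_le unfolding distrib_right by linarith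
  qed
  moreover have "soft_O N (L_A / sigma_min A * max 1 (sqrt L_f * D / sqrt \<epsilon>)) ps"
  proof (rule soft_O_I[where c = 8364000])
    define u where "u = max 1 (sqrt L_f * D / sqrt \<epsilon>)"
    have "sqrt (L / \<mu>) \<le> 2 * u"
    proof (rule real_le_lsqrt)
      have "(sqrt L_f * D / sqrt \<epsilon>)\<^sup>2 \<le> u\<^sup>2" "1 \<le> u\<^sup>2"
        using pos by (auto simp: u_def intro!: power_mono)
      moreover have "L / \<mu> = 1 + (sqrt L_f * D / sqrt \<epsilon>)\<^sup>2"
        using pos by (simp add: L_def \<mu>_def power_divide power_mult_distrib field_simps)
      ultimately show "L / \<mu> \<le> (2 * u)\<^sup>2"
        by (simp add: power_mult_distrib)
    qed (simp_all add: u_def)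
    then have "41000 * (L_A / \<sigma>) * sqrt (L / \<mu>) * (6 * lf) * (6 * lf + 11 * lf)
        \<le> 41000 * (L_A / \<sigma>) * (2 * u) * (6 * lf) * (6 * lf + 11 * lf)"
      using \<sigma> lf by (intro mult_right_mono mult_left_mono) auto
    also have "\<dots> = 8364000 * (L_A / \<sigma> * u) * lf ^ 2"
      by (simp add: power2_eq_square)
    finally show "real N \<le> 8364000 * (L_A / sigma_min A * u) * log_factor ps ^ 2"
      using N unfolding \<sigma>_def lf_def by linarith
    show "0 \<le> L_A / sigma_min A * u"
      using \<sigma> by (simp add: u_def \<sigma>_def)
  qed simp
  moreover have "\<phi> = (\<lambda>x. f x + \<epsilon> / (2 * D\<^sup>2) * (norm (x - x0))\<^sup>2)"
    by (auto simp: \<phi>_def \<mu>_def fun_eq_iff)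
  ultimately show ?thesis
    using ippa unfolding ps_def L_def \<mu>_def by auto
qed

section \<open>The nonconvex case: proximal steps on the feasible set\<close>

lemma sc_smooth_prox_objective:
  assumes "smooth_fun L f" "0 < L"
  shows "sc_smooth L (3 * L) (prox_objective f L a) (\<lambda>x. grad f x + (2 * L) *\<^sub>R (x - a))"
  using sc_smooth_add_square[OF sc_smooth_nonconvex[OF assms(1)], of L a] assms(2)
  by (simp add: prox_objective_def[abs_def])

text \<open>
  The exact proximal point \<open>xs\<close> is the projection of \<open>x - grad f xs / (2 L)\<close>, and projections
  are nonexpansive.
\<close>

lemma stationarity_le_prox_step:
  fixes A :: "real^'n^'m"
  assumes f: "smooth_fun L f" and L: "0 < L"
    and xs: "optimal_solution (prox_objective f L x) (feasible A b) xs"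
  shows "L * norm (x - closest_point (feasible A b) (x - (1 / (2 * L)) *\<^sub>R grad f x))
    \<le> 3 / 2 * (L * norm (xs - x))"
proof -
  let ?F = "feasible A b" and ?P = "closest_point (feasible A b)"
  have F: "xs \<in> ?F"
    using xs by (simp add: is_arg_min_def)
  define a where "a = x - (1 / (2 * L)) *\<^sub>R grad f xs"
  have orth: "(xs - a) \<bullet> (z - xs) = 0" if "z \<in> ?F" for z
  proof -
    have "A *v (z - xs) = 0"
      using that F by (simp add: feasible_def matrix_vector_mult_diff_distrib)
    then have "(grad f xs + (2 * L) *\<^sub>R (xs - x)) \<bullet> (z - xs) = 0"
      by (rule optimal_solution_grad_orthogonal[OF xs sc_smoothD(1)[OF sc_smooth_prox_objective[OF f L]]])
    moreover have "grad f xs + (2 * L) *\<^sub>R (xs - x) = (2 * L) *\<^sub>R (xs - a)"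
      using L by (simp add: a_def algebra_simps)
    ultimately show ?thesis
      using L by simp
  qed
  have "xs = ?P a"
  proof (rule closest_point_unique[OF convex_feasible closed_feasible F], intro ballI)
    fix z assume "z \<in> ?F"
    have "(norm (a - z))\<^sup>2 = (norm (a - xs))\<^sup>2 + (norm (z - xs))\<^sup>2 + 2 * ((xs - a) \<bullet> (z - xs))"
      unfolding power2_norm_eq_inner by (simp add: algebra_simps inner_commute)
    then have "(norm (a - xs))\<^sup>2 \<le> (norm (a - z))\<^sup>2"
      using orth[OF \<open>z \<in> ?F\<close>] by simp
    then show "dist a xs \<le> dist a z"
      by (simp add: dist_norm)
  qed
  \<comment> \<open>The factor \<open>3 / 2\<close> is \<open>1\<close> for the step itself plus
    \<open>1 / 2\<close> from a gradient of Lipschitz constant \<open>L\<close> scaled by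
    \<open>1 / (2 * L)\<close>.\<close>
  then have "norm (x - ?P (x - (1 / (2 * L)) *\<^sub>R grad f x)) \<le>
      norm (x - xs) + dist (?P a) (?P (x - (1 / (2 * L)) *\<^sub>R grad f x))"
    using norm_triangle_ineq[of "x - xs" "xs - ?P (x - (1 / (2 * L)) *\<^sub>R grad f x)"]
    by (simp add: dist_norm)
  also have "dist (?P a) (?P (x - (1 / (2 * L)) *\<^sub>R grad f x)) \<le> dist a (x - (1 / (2 * L)) *\<^sub>R grad f x)"
    using F by (intro closest_point_lipschitz convex_feasible closed_feasible) auto
  also have "\<dots> = norm (grad f x - grad f xs) / (2 * L)"
  proof -
    have "a - (x - (1 / (2 * L)) *\<^sub>R grad f x) = (1 / (2 * L)) *\<^sub>R (grad f x - grad f xs)"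
      by (simp add: a_def algebra_simps)
    then show ?thesis
      using L by (simp add: dist_norm)
  qed
  also have "\<dots> \<le> L * norm (x - xs) / (2 * L)"
    using L smooth_funD(2)[OF f, of x xs] by (intro divide_right_mono) auto
  finally have "norm (x - ?P (x - (1 / (2 * L)) *\<^sub>R grad f x)) \<le> 3 / 2 * norm (xs - x)"
    using L by (simp add: norm_minus_commute)
  then have "L * norm (x - ?P (x - (1 / (2 * L)) *\<^sub>R grad f x)) \<le> L * (3 / 2 * norm (xs - x))"
    using L by (intro mult_left_mono) auto
  then show ?thesis
    by simp
qed

text \<open>After applying \<open>transpose A\<close>, two multipliers differ by gradients and
  proximal terms only, and \<open>sigma_min A\<close> bounds the inverse on the range of
  \<open>A\<close>. This carries the multiplier bound of the first subproblem over to all later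
  ones.\<close>

lemma prox_multiplier_norm_le:
  fixes A :: "real^'n^'m"
  assumes "A \<noteq> 0" and f: "smooth_fun L f"
    and l: "l \<in> range ((*v) A)" "grad f y + (2 * L) *\<^sub>R (y - x) + transpose A *v l = 0"
    and l': "l' \<in> range ((*v) A)" "grad f y' + (2 * L) *\<^sub>R (y' - x') + transpose A *v l' = 0"
    and "0 < L"
  shows "norm l \<le> norm l' + L * (norm (y - y') + 2 * norm (y - x) + 2 * norm (y' - x')) / sigma_min A"
proof -
  have sub: "subspace (range ((*v) A))"
    by (simp add: linear_subspace_image)
  have "grad f y + (2 * L) *\<^sub>R (y - x) = - (transpose A *v l)"
    "grad f y' + (2 * L) *\<^sub>R (y' - x') = - (transpose A *v l')"
    using l(2) l'(2) by (simp_all only: eq_neg_iff_add_eq_0)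
  then have "transpose A *v (l - l') =
      - (grad f y + (2 * L) *\<^sub>R (y - x)) + (grad f y' + (2 * L) *\<^sub>R (y' - x'))"
    by (simp add: matrix_vector_mult_diff_distrib)
  also have "\<dots> = (grad f y' - grad f y) + ((2 * L) *\<^sub>R (y' - x') - (2 * L) *\<^sub>R (y - x))"
    by (simp add: algebra_simps)
  also have "norm \<dots> \<le> norm (grad f y' - grad f y) + (norm ((2 * L) *\<^sub>R (y' - x')) + norm ((2 * L) *\<^sub>R (y - x)))"
    by (intro order_trans[OF norm_triangle_ineq] add_left_mono norm_triangle_ineq4)
  also have "\<dots> \<le> L * (norm (y - y') + 2 * norm (y - x) + 2 * norm (y' - x'))"
    using smooth_funD(2)[OF f, of y' y] \<open>0 < L\<close> unfolding norm_scaleR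
    by (simp add: norm_minus_commute distrib_left)
  finally have "sigma_min A * norm (l - l') \<le> L * (norm (y - y') + 2 * norm (y - x) + 2 * norm (y' - x'))"
    using sigma_min_le_norm_transpose[OF assms(1) subspace_diff[OF sub l(1) l'(1)]] by linarith
  then have "norm (l - l') \<le> L * (norm (y - y') + 2 * norm (y - x) + 2 * norm (y' - x')) / sigma_min A"
    using sigma_min_pos[OF assms(1)] by (simp add: field_simps)
  moreover have "norm l \<le> norm l' + norm (l - l')"
    by (metis add.commute diff_add_cancel norm_triangle_ineq)
  ultimately show ?thesis
    by linarith
qed

text \<open>The invariant \<open>descent\<close> follows a feasible \<open>y\<close>, after the
  first step the exact solution that \<open>x\<close> approximates, and bounds
  \<open>f y + L_f * (norm (y - x))\<^sup>2\<close>. Each iterate that is not \<open>good\<close>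
  lowers this bound by \<open>L_f * \<tau>\<close>, so \<open>K\<close> failures would push
  \<open>f y\<close> below the infimum.\<close>

lemma prox_method_soft_O:
  fixes A :: "real^'n^'m"
  assumes A: "A \<noteq> 0" "onorm ((*v) A) \<le> L_A" and pos: "0 < L_f" "0 < \<Delta>" "0 < \<epsilon>"
    and f: "smooth_fun L_f f" and x0: "A *v x0 = b"
    and bdd: "bdd_below (f ` feasible A b)" "f x0 - (INF x\<in>feasible A b. f x) \<le> \<Delta>"
    and R: "0 < R"
  shows "\<exists>K x N. prox_method A b L_A f L_f \<Delta> (mu_Phi A (3 * L_f)) R x0 K x N \<and>
    L_f * norm (x - closest_point (feasible A b) (x - (1 / (2 * L_f)) *\<^sub>R grad f x)) \<le> \<epsilon> \<and>
    soft_O N (L_A / sigma_min A * max 1 (L_f * \<Delta> / \<epsilon>\<^sup>2))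
      [L_A, sigma_min A, L_f, \<Delta>, \<epsilon>, R,
        1 + infdist 0 (dual_solutions A b (prox_objective f L_f x0))]"
proof -
  define ps where "ps = [L_A, sigma_min A, L_f, \<Delta>, \<epsilon>, R,
    1 + infdist 0 (dual_solutions A b (prox_objective f L_f x0))]"
  define lf where "lf = log_factor ps"
  define M where "M = exp lf"
  define \<sigma> where "\<sigma> = sigma_min A"
  define F where "F = feasible A b"
  define S where "S = sqrt (\<Delta> / L_f)"
  \<comment> \<open>A lower bound for the squared length of the exact step from an iterate that is
    not \<open>good\<close>, obtained by solving \<open>stationarity_le_prox_step\<close> for the
    step.\<close>
  define \<tau> where "\<tau> = (2 * \<epsilon> / (3 * L_f))\<^sup>2"
  define u where "u = L_f * \<Delta> / \<epsilon>\<^sup>2"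
  \<comment> \<open>\<open>27 / 8 * u\<close> decreases by \<open>L_f * \<tau>\<close> amount to
    exactly \<open>3 / 2 * \<Delta>\<close>; the added \<open>1\<close> makes the contradiction
    strict.\<close>
  define K where "K = nat \<lceil>27 / 8 * u\<rceil> + 1"
  \<comment> \<open>The cost of one subproblem: \<open>41000 * 2 * 13 * 23\<close>, rounded
    up.\<close>
  define B where "B = 25000000 * (L_A / \<sigma>) * lf ^ 2"
  define ell where "ell = mu_Phi A (3 * L_f)"
  define good where "good x \<longleftrightarrow>
    L_f * norm (x - closest_point F (x - (1 / (2 * L_f)) *\<^sub>R grad f x)) \<le> \<epsilon>" for x
  have lf: "1 \<le> lf"
    unfolding lf_def by (rule log_factor_ge_one)
  have M: "2 \<le> M" "1 \<le> M" "0 < M"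
    using exp_ge_add_one_self[of lf] lf unfolding M_def by linarith+
  have M_pow: "M ^ k = exp (real k * lf)" for k
    unfolding M_def by (rule exp_of_nat_mult[symmetric])
  have \<sigma>: "0 < \<sigma>" "\<sigma> \<le> L_A" "0 < L_A"
    using sigma_min_pos[OF A(1)] sigma_min_le_bound[OF A] unfolding \<sigma>_def by linarith+
  have bd: "p \<le> M ^ 1 \<and> 1 / p \<le> M ^ 1" if "p \<in> set ps" "0 < p" for p
    unfolding M_def lf_def using log_factor_bounds[OF that] by auto
  have bds: "L_A \<le> M ^ 1" "1 / \<sigma> \<le> M ^ 1" "L_f \<le> M ^ 1" "1 / L_f \<le> M ^ 1" "\<Delta> \<le> M ^ 1"
    "1 / \<Delta> \<le> M ^ 1" "1 / \<epsilon> \<le> M ^ 1" "R \<le> M ^ 1" "1 / R \<le> M ^ 1"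
    using bd[of L_A] bd[of "sigma_min A"] bd[of L_f] bd[of \<Delta>] bd[of \<epsilon>] bd[of R] \<sigma> pos R
    by (auto simp: ps_def \<sigma>_def)
  have "1 + infdist 0 (dual_solutions A b (prox_objective f L_f x0)) \<le> M ^ 1"
    using bd[of "1 + infdist 0 (dual_solutions A b (prox_objective f L_f x0))"]
    by (auto simp: ps_def add_pos_nonneg infdist_nonneg)
  then have infdist_le: "infdist 0 (dual_solutions A b (prox_objective f L_f x0)) \<le> M ^ 1"
    by linarith
  have sc: "sc_smooth L_f (3 * L_f) (prox_objective f L_f a) (\<lambda>x. grad f x + (2 * L_f) *\<^sub>R (x - a))" for a
    by (rule sc_smooth_prox_objective[OF f pos(1)])
  have x0_F: "x0 \<in> F"
    using x0 by (simp add: F_def feasible_def)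
  have f_lower: "f x0 - \<Delta> \<le> f y" if "y \<in> F" for y
    using cINF_lower[OF bdd(1), of y] that bdd(2) by (simp add: F_def)

  have S: "0 < S" "S\<^sup>2 = \<Delta> / L_f"
    using pos by (simp_all add: S_def)
  have S_le: "S \<le> M" "1 / S \<le> M"
  proof -
    have 1: "\<Delta> / L_f \<le> M ^ 2"
      by (rule le_power_divide[OF M(2) _ pos(1) bds(5,4)]) (use pos in auto)
    have 2: "L_f / \<Delta> \<le> M ^ 2"
      by (rule le_power_divide[OF M(2) _ pos(2) bds(3,6)]) (use pos in auto)
    show "S \<le> M"
      unfolding S_def using 1 M by (intro real_le_lsqrt) auto
    have "1 / S = sqrt (L_f / \<Delta>)"
      by (simp add: S_def real_sqrt_divide)
    also have "\<dots> \<le> M"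
      using 2 M by (intro real_le_lsqrt) auto
    finally show "1 / S \<le> M" .
  qed
  have u: "0 < u" "u \<le> M ^ 4"
  proof -
    show "0 < u"
      using pos by (simp add: u_def)
    have "u = L_f * \<Delta> * (1 / \<epsilon> * (1 / \<epsilon>))"
      by (simp add: u_def power2_eq_square)
    also have "\<dots> \<le> M ^ 4"
      by (rule le_power_mult[OF M(2) _ _ le_power_mult[OF M(2) _ _ bds(3,5) order_refl]
            le_power_mult[OF M(2) _ _ bds(7,7) order_refl]]) (use pos in auto)
    finally show "u \<le> M ^ 4" .
  qed
  have K: "27 / 8 * u < real K" "real K \<le> 27 / 8 * u + 2"
  proof -
    have "0 \<le> \<lceil>27 / 8 * u\<rceil>"
      using u(1) by simp
    then have "real K = of_int \<lceil>27 / 8 * u\<rceil> + 1"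
      unfolding K_def by simp
    then show "27 / 8 * u < real K" "real K \<le> 27 / 8 * u + 2"
      using of_int_ceiling_le_add_one[of "27 / 8 * u"] le_of_int_ceiling[of "27 / 8 * u"] by linarith+
  qed
  have K_le: "12 + 3 * real K \<le> M ^ 9"
  proof -
    have "12 + 3 * real K \<le> 18 + 11 * u"
      using K(2) u(1) by simp
    also have "\<dots> \<le> M ^ 9"
    proof (rule le_power_add[OF M(1)])
      show "18 \<le> M ^ 5"
        using power_mono[of 2 M 5] M by simp
      have "11 \<le> M ^ 4"
        using power_mono[of 2 M 4] M by simp
      then show "11 * u \<le> M ^ 8"
        using le_power_mult[of M 11 u 4 4 8] u M by simp
    qed auto
    finally show ?thesis .
  qed

  have prox_point: "\<exists>y l. optimal_solution (prox_objective f L_f x) F y \<and> y \<in> F \<and>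
      l \<in> range ((*v) A) \<and> grad f y + (2 * L_f) *\<^sub>R (y - x) + transpose A *v l = 0 \<and>
      (\<forall>z\<in>F. f y + L_f * (norm (y - x))\<^sup>2 \<le> f z + L_f * (norm (z - x))\<^sup>2)" for x
  proof -
    obtain y where y: "optimal_solution (prox_objective f L_f x) F y"
      using sc_smooth_attains_min[OF sc[of x] pos(1) closed_feasible x0_F[unfolded F_def]]
      unfolding F_def by blast
    moreover obtain l where "l \<in> range ((*v) A)"
      "grad f y + (2 * L_f) *\<^sub>R (y - x) + transpose A *v l = 0"
      using multiplier_exists[OF y[unfolded F_def] sc_smoothD(1)[OF sc]] .
    moreover have "f y + L_f * (norm (y - x))\<^sup>2 \<le> f z + L_f * (norm (z - x))\<^sup>2" if "z \<in> F" for z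
      using y that by (auto simp: is_arg_min_def prox_objective_def not_less)
    ultimately show ?thesis
      by (auto simp: is_arg_min_def)
  qed
  have step_le: "norm (y - x) \<le> 2 * S"
    if "y \<in> F" "f y + L_f * (norm (y - x))\<^sup>2 \<le> f x0 + \<Delta> / 2" for x y
  proof -
    have "L_f * (norm (y - x))\<^sup>2 \<le> 4 * \<Delta>"
      using f_lower[OF that(1)] that(2) pos by linarith
    then have "(norm (y - x))\<^sup>2 \<le> (2 * S)\<^sup>2"
      using pos by (simp add: power_mult_distrib S field_simps)
    then show ?thesis
      by (rule power2_le_imp_le) (use S in simp)
  qed
  obtain y1 l1 where y1: "optimal_solution (prox_objective f L_f x0) F y1" "y1 \<in> F"
    and l1: "l1 \<in> range ((*v) A)" "grad f y1 + (2 * L_f) *\<^sub>R (y1 - x0) + transpose A *v l1 = 0"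
    and y1_le: "f y1 + L_f * (norm (y1 - x0))\<^sup>2 \<le> f x0 + L_f * (norm (x0 - x0))\<^sup>2"
    using prox_point[of x0] x0_F by blast
  have l1_le: "norm l1 \<le> M ^ 1"
    using multiplier_norm_le_infdist[OF sc _ y1(1)[unfolded F_def] l1] infdist_le pos by simp
  have y1_x0: "norm (y1 - x0) \<le> 2 * S"
    using y1_le pos by (intro step_le[OF y1(2)]) simp

  \<comment> \<open>The iterates drift from \<open>x0\<close> by at most \<open>3 * S\<close> per
    step, \<open>2 * S\<close> for the exact step and \<open>S\<close> for the inner error. The
    multipliers thus stay polynomial in the data, and every subproblem has the same logarithmic
    cost.\<close>
  have inner: "\<exists>T x' l' N. ippa A b L_A (prox_objective f L_f x) (3 * L_f) L_f ell R x T x' l' N \<and>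
      norm (x' - y) \<le> S / (2 * real (Suc k)) \<and> real N \<le> B"
    if "k < K" and x: "norm (x - x0) \<le> 3 * real k * S" and y: "y \<in> F" "norm (y - x) \<le> 2 * S"
      and l: "l \<in> range ((*v) A)" "grad f y + (2 * L_f) *\<^sub>R (y - x) + transpose A *v l = 0"
    for k x y l
  proof -
    have l_le: "norm l \<le> M ^ 13"
    proof -
      have "norm (y - y1) \<le> norm (y - x) + norm (x - x0) + norm (x0 - y1)"
        using norm_triangle_ineq[of "y - x" "x - x0"] norm_triangle_ineq[of "y - x0" "x0 - y1"] by simp
      also have "\<dots> \<le> 2 * S + 3 * real k * S + 2 * S"
        using x y(2) y1_x0 by (simp add: norm_minus_commute)
      finally have "norm (y - y1) + 2 * norm (y - x) + 2 * norm (y1 - x0) \<le> (12 + 3 * real k) * S"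
        using y(2) y1_x0 by (simp add: algebra_simps)
      also have "\<dots> \<le> (12 + 3 * real K) * S"
        using that(1) S by (intro mult_right_mono) auto
      finally have sum: "norm (y - y1) + 2 * norm (y - x) + 2 * norm (y1 - x0) \<le> (12 + 3 * real K) * S" .
      have "norm l \<le> norm l1 + L_f * (norm (y - y1) + 2 * norm (y - x) + 2 * norm (y1 - x0)) / \<sigma>"
        unfolding \<sigma>_def by (rule prox_multiplier_norm_le[OF A(1) f l l1 pos(1)])
      also have "\<dots> \<le> norm l1 + L_f * ((12 + 3 * real K) * S) / \<sigma>"
        using sum \<sigma> pos by (intro add_left_mono divide_right_mono mult_left_mono) auto
      also have "\<dots> \<le> M ^ 13"
      proof (rule le_power_add[OF M(1) l1_le])
        have "(12 + 3 * real K) * S \<le> M ^ 10"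
          using le_power_mult[OF M(2) _ _ K_le, of S 1 10] S S_le by simp
        then have "L_f * ((12 + 3 * real K) * S) \<le> M ^ 11"
          using le_power_mult[OF M(2) _ _ bds(3), of "(12 + 3 * real K) * S" 10 11] S pos by simp
        then show "L_f * ((12 + 3 * real K) * S) / \<sigma> \<le> M ^ 12"
          using le_power_divide[OF M(2) _ \<sigma>(1) _ bds(2), of "L_f * ((12 + 3 * real K) * S)" 11 12] S pos
          by simp
      qed auto
      finally show ?thesis .
    qed
    have exp13: "v \<le> exp (13 * lf)" if "v \<le> M ^ j" "j \<le> 13" for v j
      using that power_increasing[of j 13 M] M M_pow[of 13] by simp
    have L3: "3 * L_f \<le> M ^ 3"
    proof -
      have "3 \<le> M ^ 2"
        using power_mono[of 2 M 2] M by simp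
      then show ?thesis
        using le_power_mult[OF M(2) _ _ _ bds(3), of 3 2 3] pos by simp
    qed
    have xy: "norm (x - y) \<le> M ^ 2"
      using y(2) le_power_mult[OF M(2), of 2 S 1 1 2] S S_le M by (simp add: norm_minus_commute)
    define \<eta> where "\<eta> = S / (2 * real (Suc k))"
    have \<eta>: "0 < \<eta>"
      using S by (simp add: \<eta>_def)
    have inv_\<eta>: "1 / \<eta> \<le> exp (10 * lf)"
    proof -
      have "1 / \<eta> = (2 * real (Suc k)) * (1 / S)"
        by (simp add: \<eta>_def)
      also have "\<dots> \<le> M ^ 9 * M"
        using that(1) K_le S S_le M by (intro mult_mono) auto
      also have "\<dots> = exp (10 * lf)"
        using M_pow[of 10] by (simp flip: power_Suc2)
      finally show ?thesis .
    qed
    have Ay: "A *v y = b"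
      using y(1) by (simp add: F_def feasible_def)
    have "\<exists>T x' l' N. ippa A b L_A (prox_objective f L_f x) (3 * L_f) L_f ell R x T x' l' N \<and>
      norm (x' - y) \<le> \<eta> \<and>
      real N \<le> 41000 * (L_A / sigma_min A) * sqrt (3 * L_f / L_f) * (13 * lf) * (13 * lf + 10 * lf)"
      unfolding ell_def
      by (rule ippa_complexity[OF A sc pos(1) Ay l(2,1) R \<eta> _ _ exp13[OF bds(1)]
            exp13[OF bds(2)[unfolded \<sigma>_def]] exp13[OF L3] exp13[OF bds(4)] exp13[OF bds(8)]
            exp13[OF bds(9)] exp13[OF xy] exp13[OF l_le] inv_\<eta>]) (use lf in auto)
    moreover have "41000 * (L_A / sigma_min A) * sqrt (3 * L_f / L_f) * (13 * lf) * (13 * lf + 10 * lf) \<le> B"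
    proof -
      have "sqrt (3 * L_f / L_f) \<le> 2"
        using pos by (intro real_le_lsqrt) auto
      then have "41000 * (L_A / \<sigma>) * sqrt (3 * L_f / L_f) * (13 * lf) * (13 * lf + 10 * lf)
          \<le> 41000 * (L_A / \<sigma>) * 2 * (13 * lf) * (13 * lf + 10 * lf)"
        using \<sigma> lf by (intro mult_right_mono mult_left_mono) auto
      also have "\<dots> = 24518000 * (L_A / \<sigma> * lf ^ 2)"
        by (simp add: power2_eq_square)
      also have "\<dots> \<le> 25000000 * (L_A / \<sigma> * lf ^ 2)"
        using \<sigma> lf by (intro mult_right_mono mult_nonneg_nonneg) auto
      finally show ?thesis
        by (simp add: B_def \<sigma>_def mult.assoc)
    qed
    ultimately show ?thesis
      unfolding \<eta>_def by (meson order_trans)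
  qed

  have B: "0 \<le> B"
    using \<sigma> lf by (simp add: B_def)
  \<comment> \<open>The method may stop early: success at any \<open>j \<le> k\<close>
    counts.\<close>
  define finished where "finished k \<longleftrightarrow> (\<exists>j x N. j \<le> k \<and>
    prox_method A b L_A f L_f \<Delta> ell R x0 j x N \<and> good x \<and> real N \<le> real j * B)" for k
  have descent: "finished k \<or> (\<exists>x N y. prox_method A b L_A f L_f \<Delta> ell R x0 k x N \<and>
      real N \<le> real k * B \<and> y \<in> F \<and> norm (x - x0) \<le> 3 * real k * S \<and>
      f y + L_f * (norm (y - x))\<^sup>2 + real k * (L_f * \<tau>) \<le> f x0 + \<Delta> / 2 * (1 - 1 / real (Suc k)))"
    if "k \<le> K" for k
    using that
  proof (induction k)
    case 0
    show ?case
      using x0_F by (intro disjI2 exI[of _ x0] exI[of _ "0 :: nat"]) (auto intro: prox_method.init)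
  next
    case (Suc k)
    have mono: "finished k \<Longrightarrow> finished (Suc k)"
      unfolding finished_def by (meson le_Suc_eq)
    show ?case
    proof (cases "finished (Suc k)")
      case False
      with mono have "\<not> finished k"
        by blast
      with Suc obtain x N y where IH: "prox_method A b L_A f L_f \<Delta> ell R x0 k x N"
        "real N \<le> real k * B" "y \<in> F" "norm (x - x0) \<le> 3 * real k * S"
        "f y + L_f * (norm (y - x))\<^sup>2 + real k * (L_f * \<tau>) \<le> f x0 + \<Delta> / 2 * (1 - 1 / real (Suc k))"
        by auto
      have "\<not> good x"
        using \<open>\<not> finished k\<close> IH(1,2) unfolding finished_def by blast
      obtain xs l where xs: "optimal_solution (prox_objective f L_f x) F xs" "xs \<in> F"
        and l: "l \<in> range ((*v) A)" "grad f xs + (2 * L_f) *\<^sub>R (xs - x) + transpose A *v l = 0"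
        and xs_le: "f xs + L_f * (norm (xs - x))\<^sup>2 \<le> f y + L_f * (norm (y - x))\<^sup>2"
        using prox_point[of x] IH(3) by blast
      have \<tau>_lt: "L_f * \<tau> \<le> L_f * (norm (xs - x))\<^sup>2"
      proof -
        have "\<epsilon> < 3 / 2 * (L_f * norm (xs - x))"
          using stationarity_le_prox_step[OF f pos(1) xs(1)[unfolded F_def]] \<open>\<not> good x\<close>
          unfolding good_def F_def by linarith
        then have "2 * \<epsilon> / (3 * L_f) \<le> norm (xs - x)"
          using pos by (simp add: field_simps)
        then show ?thesis
          unfolding \<tau>_def using pos by (intro mult_left_mono power_mono) auto
      qed
      have half: "\<Delta> / 2 * (1 - 1 / real (Suc k)) \<le> \<Delta> / 2"
        using pos by (simp add: mult_le_cancel_left1)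
      have \<tau>_pos: "0 \<le> real k * (L_f * \<tau>)"
        using pos by (simp add: \<tau>_def)
      have xs_x: "norm (xs - x) \<le> 2 * S"
        using xs_le IH(5) half \<tau>_pos by (intro step_le[OF xs(2)]) linarith
      obtain T x' l' N' where ippa: "ippa A b L_A (prox_objective f L_f x) (3 * L_f) L_f ell R x T x' l' N'"
        and x': "norm (x' - xs) \<le> S / (2 * real (Suc k))" and N': "real N' \<le> B"
        using inner[OF _ IH(4) xs(2) xs_x l] Suc.prems by auto
      have "prox_method A b L_A f L_f \<Delta> ell R x0 (Suc k) x' (N + N')"
        using prox_method.step[OF IH(1) ippa xs(1)[unfolded F_def]] x' by (simp only: S_def)
      moreover have "real (N + N') \<le> real (Suc k) * B"
        using IH(2) N' by (simp add: algebra_simps)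
      moreover have "norm (x' - x0) \<le> 3 * real (Suc k) * S"
      proof -
        have "S / (2 * real (Suc k)) \<le> S / 1"
          using S by (intro divide_left_mono) auto
        moreover have "norm (x' - x0) \<le> norm (x' - xs) + norm (xs - x) + norm (x - x0)"
          using norm_triangle_ineq[of "x' - xs" "xs - x"] norm_triangle_ineq[of "x' - x" "x - x0"] by simp
        ultimately show ?thesis
          using x' xs_x IH(4) by (simp add: algebra_simps)
      qed
      moreover have "f xs + L_f * (norm (xs - x'))\<^sup>2 + real (Suc k) * (L_f * \<tau>)
          \<le> f x0 + \<Delta> / 2 * (1 - 1 / real (Suc (Suc k)))"
      proof -
        have "(norm (xs - x'))\<^sup>2 \<le> (S / (2 * real (Suc k)))\<^sup>2"
          using x' by (intro power_mono) (auto simp: norm_minus_commute)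
        then have "L_f * (norm (xs - x'))\<^sup>2 \<le> L_f * (S / (2 * real (Suc k)))\<^sup>2"
          using pos by (intro mult_left_mono) auto
        also have "\<dots> = \<Delta> / 2 * (1 / (2 * real (Suc k) * real (Suc k)))"
          using pos unfolding power_divide S(2) by (simp add: power2_eq_square del: of_nat_Suc)
        \<comment> \<open>The tolerance decays like \<open>1 / k\<close>, so its squares are
          dominated by a telescoping sum; this is the origin of \<open>1 - 1 / real (Suc k)\<close>
          in the invariant.\<close>
        also have "\<dots> \<le> \<Delta> / 2 * (1 / real (Suc k) - 1 / real (Suc (Suc k)))"
        proof (rule mult_left_mono)
          have "1 / (2 * real (Suc k) * real (Suc k)) \<le> 1 / (real (Suc k) * real (Suc (Suc k)))"
          proof (rule divide_left_mono)
            show "real (Suc k) * real (Suc (Suc k)) \<le> 2 * real (Suc k) * real (Suc k)"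
              by (simp add: algebra_simps)
          qed simp_all
          also have "\<dots> = 1 / real (Suc k) - 1 / real (Suc (Suc k))"
            by (simp add: field_simps)
          finally show "1 / (2 * real (Suc k) * real (Suc k)) \<le> 1 / real (Suc k) - 1 / real (Suc (Suc k))" .
        qed (use pos in simp)
        finally have err: "L_f * (norm (xs - x'))\<^sup>2 \<le> \<Delta> / 2 * (1 / real (Suc k) - 1 / real (Suc (Suc k)))" .
        have "\<Delta> / 2 * (1 - 1 / real (Suc k)) + \<Delta> / 2 * (1 / real (Suc k) - 1 / real (Suc (Suc k)))
            = \<Delta> / 2 * (1 - 1 / real (Suc (Suc k)))"
          unfolding distrib_left[symmetric] by simp
        moreover have "real (Suc k) * (L_f * \<tau>) = real k * (L_f * \<tau>) + L_f * \<tau>"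
          by (simp add: algebra_simps)
        ultimately show ?thesis
          using err xs_le IH(5) \<tau>_lt by linarith
      qed
      ultimately show ?thesis
        using xs(2) by blast
    qed simp
  qed
  have "finished K"
  proof (rule ccontr)
    assume "\<not> finished K"
    then obtain x y where y: "y \<in> F"
      "f y + L_f * (norm (y - x))\<^sup>2 + real K * (L_f * \<tau>) \<le> f x0 + \<Delta> / 2 * (1 - 1 / real (Suc K))"
      using descent[of K] by auto
    have "\<Delta> / 2 * (1 - 1 / real (Suc K)) \<le> \<Delta> / 2"
      using pos by (simp add: mult_le_cancel_left1)
    moreover have "0 \<le> L_f * (norm (y - x))\<^sup>2"
      using pos by simp
    ultimately have "real K * (L_f * \<tau>) \<le> 3 / 2 * \<Delta>"
      using y(2) f_lower[OF y(1)] by linarith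
    moreover have "27 / 8 * u * (L_f * \<tau>) = 3 / 2 * \<Delta>"
      using pos by (simp add: u_def \<tau>_def power2_eq_square field_simps)
    moreover have "27 / 8 * u * (L_f * \<tau>) < real K * (L_f * \<tau>)"
      using K(1) pos by (intro mult_strict_right_mono) (auto simp: \<tau>_def)
    ultimately show False
      by linarith
  qed
  then obtain j x N where j: "j \<le> K" "prox_method A b L_A f L_f \<Delta> ell R x0 j x N" "good x"
    "real N \<le> real j * B"
    unfolding finished_def by blast
  have "soft_O N (L_A / sigma_min A * max 1 u) ps"
  proof (rule soft_O_I[where c = 150000000])
    have "real j \<le> 6 * max 1 u"
      using j(1) K(2) by simp
    then have "real j * B \<le> 6 * max 1 u * B"
      using B by (rule mult_right_mono)
    also have "\<dots> = 150000000 * (L_A / \<sigma> * max 1 u) * lf ^ 2"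
      by (simp add: B_def)
    finally show "real N \<le> 150000000 * (L_A / sigma_min A * max 1 u) * log_factor ps ^ 2"
      using j(4) unfolding \<sigma>_def lf_def by linarith
    show "0 \<le> L_A / sigma_min A * max 1 u"
      using \<sigma> by (simp add: \<sigma>_def)
  qed simp
  then show ?thesis
    using j(2,3) unfolding ps_def u_def good_def F_def ell_def by blast
qed

theorem mainTheorem5:
  fixes A :: "real^'n^'m" and b :: "real^'m" and L_A L_f \<kappa>\<^sub>A :: real
  assumes "A \<noteq> 0"
    and "b \<in> range ((*v) A)"
    and "onorm ((*v) A) \<le> L_A"
    and "\<kappa>\<^sub>A = L_A / sigma_min A"
    and "0 < L_f"
  shows
    "(\<forall>\<mu>\<^sub>f \<kappa>\<^sub>f. 0 < \<mu>\<^sub>f \<longrightarrow> \<kappa>\<^sub>f = L_f / \<mu>\<^sub>f \<longrightarrow>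
        (\<exists>ell \<ge> mu_Phi A L_f. \<forall>f x0 x\<^sub>s R \<epsilon>.
           smooth_fun L_f f \<longrightarrow> strongly_convex \<mu>\<^sub>f f \<longrightarrow>
           optimal_solution f (feasible A b) x\<^sub>s \<longrightarrow> 0 < R \<longrightarrow> 0 < \<epsilon> \<longrightarrow>
           (\<exists>T x l N.
              ippa A b L_A f L_f \<mu>\<^sub>f ell R x0 T x l N \<and>
              (norm (x - x\<^sub>s))\<^sup>2 \<le> \<epsilon> \<and>
              soft_O N (\<kappa>\<^sub>A * sqrt \<kappa>\<^sub>f * max 1 (ln (1 / \<epsilon>)))
                [L_A, sigma_min A, L_f, \<mu>\<^sub>f, R, 1 + norm (x0 - x\<^sub>s),
                 1 + infdist 0 (dual_solutions A b f)])))
     \<and>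
     (\<forall>D \<epsilon>. 0 < D \<longrightarrow> 0 < \<epsilon> \<longrightarrow>
        (\<exists>ell \<ge> mu_Phi A (L_f + \<epsilon> / D\<^sup>2). \<forall>f x0 x\<^sub>s R \<rho>.
           smooth_fun L_f f \<longrightarrow> convex_on UNIV f \<longrightarrow>
           optimal_solution f (feasible A b) x\<^sub>s \<longrightarrow> norm (x0 - x\<^sub>s) \<le> D \<longrightarrow>
           0 < R \<longrightarrow> 0 < \<rho> \<longrightarrow>
           (\<exists>T x l N.
              ippa A b L_A (\<lambda>x. f x + \<epsilon> / (2 * D\<^sup>2) * (norm (x - x0))\<^sup>2)
                (L_f + \<epsilon> / D\<^sup>2) (\<epsilon> / D\<^sup>2) ell R x0 T x l N \<and>
              f x + \<rho> * norm (A *v x - b) - f x\<^sub>s \<le> \<epsilon> \<and>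
              soft_O N (\<kappa>\<^sub>A * max 1 (sqrt L_f * D / sqrt \<epsilon>))
                [L_A, sigma_min A, L_f, D, \<epsilon>, R, 1 + \<rho>,
                 1 + infdist 0 (dual_solutions A b f)])))
     \<and>
     (\<exists>ell \<ge> mu_Phi A (3 * L_f). \<forall>f x0 R \<Delta> \<epsilon>.
        smooth_fun L_f f \<longrightarrow> A *v x0 = b \<longrightarrow>
        bdd_below (f ` feasible A b) \<longrightarrow> f x0 - (INF x\<in>feasible A b. f x) \<le> \<Delta> \<longrightarrow>
        0 < R \<longrightarrow> 0 < \<Delta> \<longrightarrow> 0 < \<epsilon> \<longrightarrow>
        (\<exists>K x N.
           prox_method A b L_A f L_f \<Delta> ell R x0 K x N \<and>
           L_f * norm (x - closest_point (feasible A b) (x - (1 / (2 * L_f)) *\<^sub>R grad f x)) \<le> \<epsilon> \<and>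
           soft_O N (\<kappa>\<^sub>A * max 1 (L_f * \<Delta> / \<epsilon>\<^sup>2))
             [L_A, sigma_min A, L_f, \<Delta>, \<epsilon>, R,
              1 + infdist 0 (dual_solutions A b (prox_objective f L_f x0))]))"
proof -
  note A = assms(1,3)
  show ?thesis
    unfolding assms(4)
  proof (intro conjI allI impI, goal_cases)
    case (1 \<mu>\<^sub>f \<kappa>\<^sub>f)
    then show ?case
      using ippa_soft_O_strongly_convex[OF A assms(5), of \<mu>\<^sub>f]
      by (intro exI[of _ "mu_Phi A L_f"] conjI order_refl allI impI) blast
  next
    case (2 D \<epsilon>)
    then show ?case
      using ippa_soft_O_convex[OF A assms(5), of D \<epsilon>]
      by (intro exI[of _ "mu_Phi A (L_f + \<epsilon> / D\<^sup>2)"] conjI order_refl allI impI) blast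
  next
    case 3
    show ?case
      using prox_method_soft_O[OF A assms(5)]
      by (intro exI[of _ "mu_Phi A (3 * L_f)"] conjI order_refl allI impI) blast
  qed
qed

end
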